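(* Let $-B_c\in\mathcal B(\mathcal H)$ be semi-dissipative. Then $B_c$ is hypocoercive (with hypocoercivity index $m_{HC}\in\mathbb N_0$, i.e. the index exists and is denoted $m_{HC}$) if and only if there exist $a,c>0$ such that $$\|e^{-B_c t}\| = 1-ct^a+o(t^a)\quad\text{for } t\to 0+ .$$ In this case, necessarily $a=2m_{HC}+1$ and $$c=\frac{1}{(2m_{HC}+1)!\,\binom{2m_{HC}}{m_{HC}}}\ \lim_{\delta\to0}\ \inf_{\substack{\|\sqrt{B_H}B_c^p y\|\le\delta,\ 0\le p<m_{HC}\\ \|y\|=1}}\left\|\sqrt{B_H}\,B_c^{m_{HC}}y\right\|^2 .$$
   Context: $\mathcal H$ is a nonzero separable complex Hilbert space and $\mathcal B(\mathcal H)$ is the set of bounded linear operators on it; $\|\cdot\|$ is the Hilbert space norm, respectively the operator norm. For $B_c\in\mathcal B(\mathcal H)$, $B_H:=\frac{B_c+B_c^*}{2}$ is its Hermitian part. $-B_c$ is called semi-dissipative if $B_H\ge0$ (positive semidefinite); $\sqrt{B_H}$ is the positive semidefinite square root. $B_c$ is hypocoercive if there exist $C\ge1$, $\lambda>0$ with $\|e^{-B_ct}x^0\|\le Ce^{-\lambda t}\|x^0\|$ for all $x^0\in\mathcal H$, $t\ge0$. For semi-dissipative $-B_c$, the hypocoercivity index $m_{HC}$ of $B_c$ is the smallest $m\in\mathbb N_0$ (if it exists) such that $\sum_{j=0}^m (B_c^* )^jB_HB_c^j\ge\kappa I$ for some $\kappa>0$. The infimum is over $y\in\mathcal H$ satisfying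 the listed constraints; for $m_{HC}=0$ it is over all unit vectors. The limit is for $\delta\to0+$. *)

theory Defs
  imports "HOL-Analysis.Analysis" "HOL-Library.Landau_Symbols" "HOL-Library.Nonpos_Ints"
begin

section \<open>Complex Hilbert spaces\<close>

text \<open>
  The inner product is antilinear in its first argument. A complex inner product space is also
  a real one, with real inner product \<open>Re (cinner x y)\<close>; in particular
  \<open>norm x = sqrt (Re (cinner x x))\<close>.
\<close>

class complex_inner = real_inner +
  fixes scaleC :: "complex \<Rightarrow> 'a \<Rightarrow> 'a" (infixr "*\<^sub>C" 75)
    and cinner :: "'a \<Rightarrow> 'a \<Rightarrow> complex"
  assumes scaleC_add_right: "c *\<^sub>C (x + y) = c *\<^sub>C x + c *\<^sub>C y"
    and scaleC_add_left: "(c + d) *\<^sub>C x = c *\<^sub>C x + d *\<^sub>C x"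
    and scaleC_scaleC: "c *\<^sub>C (d *\<^sub>C x) = (c * d) *\<^sub>C x"
    and scaleC_of_real: "complex_of_real r *\<^sub>C x = r *\<^sub>R x"
    and cinner_commute: "cinner x y = cnj (cinner y x)"
    and cinner_add_right: "cinner x (y + z) = cinner x y + cinner x z"
    and cinner_scaleC_right: "cinner x (c *\<^sub>C y) = c * cinner x y"
    and Re_cinner: "Re (cinner x y) = inner x y"

class nonzero_complex_hilbert = complex_inner + complete_space +
  assumes ex_nonzero: "\<exists>x. x \<noteq> 0"

subclass (in nonzero_complex_hilbert) banach ..

instantiation complex :: nonzero_complex_hilbert
begin

definition scaleC_complex :: "complex \<Rightarrow> complex \<Rightarrow> complex"
  where "scaleC_complex c x = c * x"

definition cinner_complex :: "complex \<Rightarrow> complex \<Rightarrow> complex"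
  where "cinner_complex x y = cnj x * y"

instance
  by standard
    (auto simp: scaleC_complex_def cinner_complex_def algebra_simps scaleR_conv_of_real
      inner_complex_def intro: exI[of _ 1])

end

section \<open>The Banach algebra of bounded linear operators\<close>

text \<open>
  Multiplication is composition and the norm is the operator norm, so that the library functions
  \<open>(^)\<close> and \<open>exp\<close> are the operator power and the operator exponential.
\<close>

typedef (overloaded) 'a cop =
  "{A :: 'a::complex_inner \<Rightarrow>\<^sub>L 'a. \<forall>c x. blinfun_apply A (c *\<^sub>C x) = c *\<^sub>C blinfun_apply A x}"
  morphisms blinfun_of_cop Cop
  by (rule exI[of _ id_blinfun]) simp

setup_lifting type_definition_cop

lift_definition cop_apply :: "'a::complex_inner cop \<Rightarrow> 'a \<Rightarrow> 'a" is blinfun_apply .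

declare [[coercion cop_apply]]

lemma scaleC_scaleR_commute: "c *\<^sub>C (r *\<^sub>R x) = r *\<^sub>R (c *\<^sub>C (x::'a::complex_inner))"
  by (simp flip: scaleC_of_real add: scaleC_scaleC mult.commute)

lemma scaleC_zero_right [simp]: "c *\<^sub>C (0::'a::complex_inner) = 0"
  using scaleC_add_right[of c 0 "0::'a"] by simp

lemma scaleC_minus_right: "c *\<^sub>C (- x) = - (c *\<^sub>C (x::'a::complex_inner))"
  using scaleC_scaleR_commute[of c "-1" x] by simp

lemma scaleC_diff_right: "c *\<^sub>C (x - y) = c *\<^sub>C x - c *\<^sub>C (y::'a::complex_inner)"
  using scaleC_add_right[of c x "- y"] by (simp add: scaleC_minus_right)

lemma norm_scaleC: "norm (c *\<^sub>C x) = norm c * norm (x::'a::complex_inner)"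
proof -
  have "cinner (c *\<^sub>C x) (c *\<^sub>C x) = c * cnj c * cinner x x"
    by (metis cinner_commute cinner_scaleC_right complex_cnj_mult mult.assoc)
  also have "c * cnj c = complex_of_real ((norm c)\<^sup>2)"
    by (simp add: complex_mult_cnj cmod_power2)
  finally have "(norm (c *\<^sub>C x))\<^sup>2 = (norm c)\<^sup>2 * (norm x)\<^sup>2"
    by (simp add: power2_norm_eq_inner flip: Re_cinner)
  then show ?thesis
    by (metis norm_ge_zero mult_nonneg_nonneg power2_eq_imp_eq power_mult_distrib)
qed

lemma bounded_linear_scaleC: "bounded_linear (\<lambda>x::'a::complex_inner. c *\<^sub>C x)"
  by (rule bounded_linear_intro[where K="norm c"])
    (auto simp: scaleC_add_right scaleC_scaleR_commute norm_scaleC)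

instantiation cop :: (complex_inner) real_normed_vector
begin

lift_definition norm_cop :: "'a cop \<Rightarrow> real" is norm .
lift_definition zero_cop :: "'a cop" is 0 by simp
lift_definition plus_cop :: "'a cop \<Rightarrow> 'a cop \<Rightarrow> 'a cop" is "(+)"
  by (simp add: blinfun.add_left scaleC_add_right)
lift_definition minus_cop :: "'a cop \<Rightarrow> 'a cop \<Rightarrow> 'a cop" is "(-)"
  by (simp add: blinfun.diff_left scaleC_diff_right)
lift_definition uminus_cop :: "'a cop \<Rightarrow> 'a cop" is uminus
  by (simp add: blinfun.minus_left scaleC_minus_right)
lift_definition scaleR_cop :: "real \<Rightarrow> 'a cop \<Rightarrow> 'a cop" is "(*\<^sub>R)"
  by (simp add: blinfun.scaleR_left scaleC_scaleR_commute)

definition dist_cop :: "'a cop \<Rightarrow> 'a cop \<Rightarrow> real"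
  where "dist_cop A B = norm (A - B)"

definition uniformity_cop :: "('a cop \<times> 'a cop) filter"
  where "uniformity_cop = (INF e\<in>{0 <..}. principal {(x, y). dist x y < e})"

definition open_cop :: "'a cop set \<Rightarrow> bool"
  where "open_cop S = (\<forall>x\<in>S. \<forall>\<^sub>F (x', y) in uniformity. x' = x \<longrightarrow> y \<in> S)"

definition sgn_cop :: "'a cop \<Rightarrow> 'a cop"
  where "sgn_cop A = inverse (norm A) *\<^sub>R A"

instance
  apply standard
  unfolding dist_cop_def open_cop_def sgn_cop_def uniformity_cop_def
  by (rule refl | (transfer, force simp: norm_triangle_ineq algebra_simps))+

end

instantiation cop :: (nonzero_complex_hilbert) real_normed_algebra_1
begin

lift_definition one_cop :: "'a cop" is id_blinfun by simp
lift_definition times_cop :: "'a cop \<Rightarrow> 'a cop \<Rightarrow> 'a cop" is "(o\<^sub>L)" by simp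

instance
proof
  fix A B C :: "'a cop" and r :: real
  show "A * B * C = A * (B * C)" by transfer (auto intro: blinfun_eqI)
  show "(A + B) * C = A * C + B * C"
    by transfer (auto intro!: blinfun_eqI simp: blinfun.bilinear_simps)
  show "A * (B + C) = A * B + A * C"
    by transfer (auto intro!: blinfun_eqI simp: blinfun.bilinear_simps)
  show "r *\<^sub>R A * B = r *\<^sub>R (A * B)"
    by transfer (auto intro!: blinfun_eqI simp: blinfun.bilinear_simps)
  show "A * r *\<^sub>R B = r *\<^sub>R (A * B)"
    by transfer (auto intro!: blinfun_eqI simp: blinfun.bilinear_simps)
  show "1 * A = A" by transfer (auto intro: blinfun_eqI)
  show "A * 1 = A" by transfer (auto intro: blinfun_eqI)
  show "norm (A * B) \<le> norm A * norm B" by transfer (rule norm_blinfun_compose)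
  obtain x :: 'a where x: "x \<noteq> 0" using ex_nonzero by blast
  have n1: "norm (id_blinfun :: 'a \<Rightarrow>\<^sub>L 'a) = 1"
    by (rule norm_blinfun_eqI[where x=x]) (use x in auto)
  show "norm (1 :: 'a cop) = 1" by transfer (rule n1)
  then show "(0 :: 'a cop) \<noteq> 1" by (metis norm_zero zero_neq_one)
qed

end

lemma blinfun_of_cop_scaleC: "blinfun_of_cop A (c *\<^sub>C x) = c *\<^sub>C blinfun_of_cop A x"
  using blinfun_of_cop[of A] by simp

lemma norm_blinfun_of_cop: "norm (blinfun_of_cop A - blinfun_of_cop B) = norm (A - B)"
  by transfer simp

instance cop :: (nonzero_complex_hilbert) banach
proof
  fix X :: "nat \<Rightarrow> 'a cop"
  assume X: "Cauchy X"
  have "Cauchy (\<lambda>n. blinfun_of_cop (X n))"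
    using X by (simp add: Cauchy_def dist_norm norm_blinfun_of_cop)
  then obtain L where L: "(\<lambda>n. blinfun_of_cop (X n)) \<longlonglongrightarrow> L"
    using Cauchy_convergent convergent_def by blast
  have ptw: "(\<lambda>n. blinfun_of_cop (X n) x) \<longlonglongrightarrow> L x" for x
    by (intro tendsto_intros L)
  have "L (c *\<^sub>C x) = c *\<^sub>C L x" for c x
  proof (rule LIMSEQ_unique[OF ptw])
    have "(\<lambda>n. c *\<^sub>C (blinfun_of_cop (X n) x)) \<longlonglongrightarrow> c *\<^sub>C L x"
      by (rule bounded_linear.tendsto[OF bounded_linear_scaleC ptw])
    then show "(\<lambda>n. blinfun_of_cop (X n) (c *\<^sub>C x)) \<longlonglongrightarrow> c *\<^sub>C L x"
      by (simp add: blinfun_of_cop_scaleC)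
  qed
  then have "blinfun_of_cop (Cop L) = L" by (simp add: Cop_inverse)
  then have "X \<longlonglongrightarrow> Cop L"
    using L by (simp add: tendsto_iff dist_norm flip: norm_blinfun_of_cop)
  then show "convergent X" by (auto simp: convergent_def)
qed

lemma norm_cop_eq_onorm: "norm A = onorm (cop_apply A)"
  by transfer (rule norm_blinfun.rep_eq)

lemma cop_apply_algebra [simp]:
  "cop_apply (A + B) x = cop_apply A x + cop_apply B x"
  "cop_apply (A - B) x = cop_apply A x - cop_apply B x"
  "cop_apply (r *\<^sub>R A) x = r *\<^sub>R cop_apply A x"
  by (transfer, simp add: blinfun.bilinear_simps)+

lemma cop_apply_mult [simp]:
  "cop_apply (A * B) x = cop_apply A (cop_apply B x)" "cop_apply 1 x = x"
  by (transfer, simp)+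

section \<open>Adjoint, positivity, square root\<close>

text \<open>The adjoint exists by the Riesz representation theorem.\<close>

definition cadjoint :: "'a::nonzero_complex_hilbert cop \<Rightarrow> 'a cop"
  where "cadjoint B = (THE A :: 'a cop. \<forall>x y. cinner (A x) y = cinner x (B y))"

definition herm :: "'a::nonzero_complex_hilbert cop \<Rightarrow> 'a cop"
  where "herm B = (1/2) *\<^sub>R (B + cadjoint B)"

text \<open>On a complex space the quadratic form being real entails self-adjointness.\<close>

definition psd :: "'a::nonzero_complex_hilbert cop \<Rightarrow> bool"
  where "psd A \<longleftrightarrow> (\<forall>x. cinner x (A x) \<in> \<real>\<^sub>\<ge>\<^sub>0)"

definition sqrt_cop :: "'a::nonzero_complex_hilbert cop \<Rightarrow> 'a cop"
  where "sqrt_cop A = (THE S :: 'a cop. psd S \<and> S * S = A)"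

section \<open>Hypocoercivity\<close>

text \<open>\<open>semi_dissipative A\<close> is to be applied to \<open>A = - B\<close>: the Hermitian part of \<open>- A\<close> is \<open>\<ge> 0\<close>.\<close>

definition semi_dissipative :: "'a::nonzero_complex_hilbert cop \<Rightarrow> bool"
  where "semi_dissipative A \<longleftrightarrow> psd (herm (- A))"

definition hypocoercive :: "'a::nonzero_complex_hilbert cop \<Rightarrow> bool"
  where "hypocoercive B \<longleftrightarrow>
    (\<exists>C\<ge>1. \<exists>\<mu>>0. \<forall>x. \<forall>t\<ge>0. norm (exp (- (t *\<^sub>R B)) x) \<le> C * exp (- \<mu> * t) * norm x)"

definition hc_condition :: "'a::nonzero_complex_hilbert cop \<Rightarrow> nat \<Rightarrow> bool"
  where "hc_condition B m \<longleftrightarrow>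
    (\<exists>\<kappa>>0. psd ((\<Sum>j\<le>m. cadjoint B ^ j * herm B * B ^ j) - \<kappa> *\<^sub>R 1))"

definition is_hc_index :: "'a::nonzero_complex_hilbert cop \<Rightarrow> nat \<Rightarrow> bool"
  where "is_hc_index B m \<longleftrightarrow> hc_condition B m \<and> (\<forall>k<m. \<not> hc_condition B k)"

text \<open>\<open>norm (exp (- t B)) = 1 - c t\<^sup>a + o(t\<^sup>a)\<close> as \<open>t \<rightarrow> 0+\<close>\<close>

definition norm_exp_expansion :: "'a::nonzero_complex_hilbert cop \<Rightarrow> real \<Rightarrow> real \<Rightarrow> bool"
  where "norm_exp_expansion B a c \<longleftrightarrow>
    (\<lambda>t. norm (exp (- (t *\<^sub>R B))) - (1 - c * t powr a)) \<in> o[at_right 0](\<lambda>t. t powr a)"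

text \<open>The set over which the infimum is taken; for \<open>m = 0\<close> it is the unit sphere.\<close>

definition hc_constraint :: "'a::nonzero_complex_hilbert cop \<Rightarrow> nat \<Rightarrow> real \<Rightarrow> 'a set"
  where "hc_constraint B m \<delta> =
    {y. norm y = 1 \<and> (\<forall>p<m. norm ((sqrt_cop (herm B) * B ^ p) y) \<le> \<delta>)}"

end

theory Submission
  imports Defs
begin

text \<open>
  Write \<open>P t = exp (- t B)\<close>, \<open>S = sqrt (herm B)\<close>, and call the vectors \<open>S B\<^sup>j x\<close> the
  observations of \<open>x\<close>. Differentiating \<open>\<parallel>P t x\<parallel>\<^sup>2\<close> gives \<open>-2 \<parallel>S P t x\<parallel>\<^sup>2\<close>, so
  \<open>(\<parallel>x\<parallel>\<^sup>2 - \<parallel>P t x\<parallel>\<^sup>2) / (2 t)\<close> is the mean of \<open>\<parallel>S P (t u) x\<parallel>\<^sup>2\<close> over \<open>u \<in> [0, 1]\<close>; this is the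
  dissipation of \<open>x\<close>, and the norm of \<open>P t\<close> is governed by its infimum over unit vectors.

  For small \<open>t\<close> the curve \<open>u \<mapsto> S P (t u) x\<close> is, up to \<open>O(t\<^bsup>m+1\<^esup>)\<close>, a polynomial of degree \<open>m\<close> in \<open>u\<close>
  whose coefficients are multiples of the observations of order at most \<open>m\<close>. Among all polynomials of
  degree \<open>m\<close> with a given leading coefficient the shifted Legendre polynomial has the smallest mean square
  on \<open>[0, 1]\<close>, which produces the universal constant. This yields a lower bound for the dissipation in terms
  of \<open>\<parallel>S B\<^sup>m x\<parallel>\<^sup>2\<close> alone (\<open>dissipation_lower_bound\<close>). It is attained to leading order
  (\<open>dissipation_upper_bound\<close>): if the observations of \<open>y\<close> of order less than \<open>m\<close> are negligible, then
  replacing \<open>y\<close> by \<open>q (t B) y\<close> for a suitable polynomial \<open>q\<close> with \<open>q 0 = 1\<close> changes \<open>y\<close> by only \<open>O(t)\<close> and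
  turns the curve to leading order into a multiple of the Legendre polynomial.

  Let \<open>m\<close> be the hypocoercivity index. The lower bounds of orders below \<open>m\<close> show that unit vectors with dissipation
  of order \<open>t\<^bsup>2m\<^esup>\<close> have small observations of order less than \<open>m\<close>, hence only such vectors compete for the
  infimum; minimality of \<open>m\<close> says that they exist, and the coercivity condition at \<open>m\<close> keeps
  \<open>\<parallel>S B\<^sup>m x\<parallel>\<close> away from zero on them. Both bounds together give
  \<open>(1 - \<parallel>P t\<parallel>) / t\<^bsup>2m+1\<^esup> \<longlonglongrightarrow> decay_const m * L\<close> with \<open>L > 0\<close> (\<open>norm_P_asymptotics\<close>).

  The equivalence is completed by two short arguments. Any expansion with \<open>c > 0\<close> forces \<open>\<parallel>P t\<parallel> < 1\<close> for some
  \<open>t > 0\<close>, and the semigroup law turns this into exponential decay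
  (\<open>hypocoercive_if_strict_contraction\<close>). Conversely, exponential decay gives \<open>\<parallel>P t\<parallel> < 1\<close> for some \<open>t\<close>, so the
  dissipation at time \<open>t\<close> is coercive; truncating the exponential series far enough shows that finitely many
  observations are already coercive (\<open>hc_condition_if_hypocoercive\<close>).
\<close>

section \<open>Adjoints and positive operators\<close>

text \<open>
  The representing vector is the minimiser of \<open>J x = \<parallel>x\<parallel>\<^sup>2 - 2 f x\<close>: a minimising sequence is Cauchy
  by the parallelogram law, and stationarity of \<open>J\<close> at its limit is the claimed identity.
\<close>

lemma riesz_representation:
  fixes f :: "'a::{real_inner,complete_space} \<Rightarrow> real"
  assumes "bounded_linear f"
  shows "\<exists>z. \<forall>x. f x = z \<bullet> x"
proof -
  interpret f: bounded_linear f by fact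
  define J where "J x = x \<bullet> x - 2 * f x" for x
  obtain K where K: "\<And>x. norm (f x) \<le> norm x * K" "K > 0"
    using f.pos_bounded by blast
  have lower: "J x \<ge> - K\<^sup>2" for x
  proof -
    have "f x \<le> norm x * K" using K(1)[of x] by simp
    moreover have "0 \<le> (norm x - K)\<^sup>2" by simp
    ultimately show ?thesis
      by (simp add: J_def power2_diff flip: power2_norm_eq_inner)
  qed
  have bdd: "bdd_below (range J)" using lower by (intro bdd_belowI2[of _ "- K\<^sup>2"])
  define d where "d = Inf (range J)"
  have d: "d \<le> J x" for x
    unfolding d_def by (rule cInf_lower[OF _ bdd]) simp
  have "\<exists>x. J x < d + inverse (Suc n)" for n
    using cInf_lessD[of "range J" "d + inverse (Suc n)"] unfolding d_def by auto
  then obtain X where X: "\<And>n. J (X n) < d + inverse (Suc n)" by metis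
  have par: "(norm (x - y))\<^sup>2 = 2 * J x + 2 * J y - 4 * J ((1/2) *\<^sub>R (x + y))" for x y
    unfolding J_def power2_norm_eq_inner
    by (simp add: f.scaleR f.add inner_simps inner_commute algebra_simps)
  have dist: "(norm (X i - X j))\<^sup>2 \<le> 2 * inverse (Suc i) + 2 * inverse (Suc j)" for i j
    using par[of "X i" "X j"] X[of i] X[of j] d[of "(1/2) *\<^sub>R (X i + X j)"] by linarith
  have "Cauchy X"
  proof (rule CauchyI)
    fix e :: real assume e: "e > 0"
    obtain M where M: "inverse (Suc M) < e\<^sup>2 / 4"
      using reals_Archimedean[of "e\<^sup>2/4"] e by auto
    have "norm (X i - X j) < e" if "i \<ge> M" "j \<ge> M" for i j
    proof -
      have "inverse (real (Suc i)) \<le> inverse (real (Suc M))" "inverse (real (Suc j)) \<le> inverse (real (Suc M))"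
        using that by (auto intro!: le_imp_inverse_le)
      then have "(norm (X i - X j))\<^sup>2 < e\<^sup>2" using dist[of i j] M by linarith
      then show ?thesis using e by (simp add: power2_less_imp_less)
    qed
    then show "\<exists>M. \<forall>i\<ge>M. \<forall>j\<ge>M. norm (X i - X j) < e" by blast
  qed
  then obtain z where z: "X \<longlonglongrightarrow> z" using Cauchy_convergent convergent_def by blast
  have "(\<lambda>n. J (X n)) \<longlonglongrightarrow> J z"
    unfolding J_def by (intro tendsto_intros z f.tendsto)
  moreover have "(\<lambda>n. d + inverse (Suc n)) \<longlonglongrightarrow> d + 0"
    by (intro tendsto_intros LIMSEQ_inverse_real_of_nat)
  ultimately have Jz: "J z \<le> d + 0"
    by (rule LIMSEQ_le) (use X in \<open>auto intro: less_imp_le\<close>)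
  have "f h = z \<bullet> h" for h
  proof -
    define g where "g = z \<bullet> h - f h"
    define b where "b = h \<bullet> h"
    \<comment> \<open>The minimising step of the quadratic would be \<open>- g / b\<close>; adding \<open>1\<close> avoids dividing by zero.\<close>
    define s where "s = - g / (b + 1)"
    have b: "b \<ge> 0" by (simp add: b_def)
    have "J z \<le> J (z + s *\<^sub>R h)" using Jz d[of "z + s *\<^sub>R h"] by simp
    then have "0 \<le> 2 * s * g + s\<^sup>2 * b"
      unfolding J_def g_def b_def
      by (simp add: f.scaleR f.add inner_simps inner_commute algebra_simps power2_eq_square)
    also have "s\<^sup>2 * b \<le> s\<^sup>2 * (b + 1)" by (simp add: mult_left_mono)
    also have "s\<^sup>2 * (b + 1) = s * (s * (b + 1))" by (simp add: power2_eq_square)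
    also have "s * (b + 1) = - g" using b by (simp add: s_def)
    finally have "0 \<le> s * g" by (simp add: mult.commute)
    then have "g * g / (b + 1) \<le> 0" by (simp add: s_def)
    then have "g * g \<le> 0" using b by (simp add: divide_le_0_iff)
    then have "g = 0" by (metis mult_eq_0_iff not_square_less_zero order_le_imp_less_or_eq)
    then show ?thesis by (simp add: g_def)
  qed
  then show ?thesis by blast
qed

lemma cop_eqI:
  fixes A B :: "'a::complex_inner cop"
  shows "(\<And>x. A x = B x) \<Longrightarrow> A = B"
  by transfer (rule blinfun_eqI)

lemma ex_cop:
  assumes "bounded_linear f" and "\<And>c x. f (c *\<^sub>C x) = c *\<^sub>C f x"
  shows "\<exists>A :: 'a::complex_inner cop. \<forall>x. cop_apply A x = f x"
proof -
  have "blinfun_of_cop (Cop (Blinfun f)) = Blinfun f"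
    by (rule Cop_inverse) (use assms in \<open>simp add: bounded_linear_Blinfun_apply\<close>)
  then show ?thesis
    using assms by (intro exI[of _ "Cop (Blinfun f)"]) (simp add: cop_apply.rep_eq bounded_linear_Blinfun_apply)
qed

lemma bounded_linear_cop_apply: "bounded_linear (cop_apply A)"
  by transfer (rule blinfun.bounded_linear_right)

lemma bounded_linear_cop_eval: "bounded_linear (\<lambda>A. cop_apply A x)"
proof (rule bounded_linear_intro[where K = "norm x"])
  show "norm (cop_apply A x) \<le> norm A * norm x" for A
    by transfer (rule norm_blinfun)
qed auto

lemma norm_cop_apply: "norm (cop_apply A x) \<le> norm A * norm x"
  by transfer (rule norm_blinfun)

lemma cop_apply_scaleC: "cop_apply A (c *\<^sub>C x) = c *\<^sub>C cop_apply A x"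
  by transfer simp

lemma inner_scaleC_left: "(c *\<^sub>C x) \<bullet> y = x \<bullet> (cnj c *\<^sub>C (y::'a::complex_inner))"
proof -
  have "cinner (c *\<^sub>C x) y = cinner x (cnj c *\<^sub>C y)"
    by (metis cinner_commute cinner_scaleC_right complex_cnj_mult)
  then show ?thesis by (simp flip: Re_cinner)
qed

lemma Im_cinner: "Im (cinner x y) = - (x \<bullet> (\<i> *\<^sub>C (y::'a::complex_inner)))"
  by (simp add: cinner_scaleC_right flip: Re_cinner)

text \<open>
  Riesz representation of \<open>y \<mapsto> x \<bullet> B y\<close> for each \<open>x\<close> yields a bounded complex-linear operator, so the
  definite description defining the adjoint is meaningful. Working with the real inner product
  suffices, since the imaginary part of \<open>cinner\<close> is recovered by multiplying one argument by \<open>\<i>\<close>.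
\<close>

lemma cadjoint_inner:
  fixes B :: "'a::nonzero_complex_hilbert cop"
  shows "cadjoint B x \<bullet> y = x \<bullet> B y"
proof -
  interpret B: bounded_linear "cop_apply B" by (rule bounded_linear_cop_apply)
  have "bounded_linear (\<lambda>y. x \<bullet> B y)" for x
    using bounded_linear_compose[OF bounded_linear_inner_right bounded_linear_cop_apply] .
  from riesz_representation[OF this] obtain g where g: "\<And>x y. x \<bullet> B y = g x \<bullet> y"
    by metis
  have eqI: "u = v" if "\<And>y. u \<bullet> y = v \<bullet> y" for u v :: 'a
    using that[of "u - v"] by (metis inner_diff_left inner_eq_zero_iff right_minus_eq)
  have "bounded_linear g"
  proof (rule bounded_linear_intro[where K = "norm B"])
    show "g (x + y) = g x + g y" for x y
      by (rule eqI) (simp add: inner_simps flip: g)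
    show "g (r *\<^sub>R x) = r *\<^sub>R g x" for r x
      by (rule eqI) (simp add: inner_simps flip: g)
    show "norm (g x) \<le> norm x * norm B" for x
    proof -
      have "(norm (g x))\<^sup>2 = x \<bullet> B (g x)" by (simp add: power2_norm_eq_inner g)
      also have "\<dots> \<le> norm x * (norm B * norm (g x))"
        by (rule order_trans[OF norm_cauchy_schwarz]) (simp add: mult_left_mono norm_cop_apply)
      finally show ?thesis
        by (cases "norm (g x) = 0") (auto simp: power2_eq_square)
    qed
  qed
  moreover have "g (c *\<^sub>C x) = c *\<^sub>C g x" for c x
    by (rule eqI) (simp add: inner_scaleC_left cop_apply_scaleC flip: g)
  ultimately obtain A :: "'a cop" where "\<And>x. cop_apply A x = g x" using ex_cop by metis
  then have A: "A x \<bullet> y = x \<bullet> B y" for x y by (simp add: g)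
  have "cadjoint B = A" unfolding cadjoint_def
  proof (rule the_equality)
    show "\<forall>x y. cinner (A x) y = cinner x (B y)"
      by (auto simp: complex_eq_iff Re_cinner Im_cinner A cop_apply_scaleC)
    fix A' :: "'a cop" assume "\<forall>x y. cinner (A' x) y = cinner x (B y)"
    then have "A' x \<bullet> y = x \<bullet> B y" for x y by (metis Re_cinner)
    then show "A' = A" by (intro cop_eqI eqI) (simp add: A)
  qed
  then show ?thesis by (simp add: A)
qed

text \<open>
  Polarising the vanishing imaginary part of the quadratic form, at \<open>x + y\<close> and at \<open>x + \<i> y\<close>,
  gives symmetry with respect to the real inner product. From here on only that real inner product is used.
\<close>

lemma psd_iff:
  fixes A :: "'a::nonzero_complex_hilbert cop"
  shows "psd A \<longleftrightarrow> (\<forall>x y. A x \<bullet> y = x \<bullet> A y) \<and> (\<forall>x. 0 \<le> x \<bullet> A x)"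
proof
  interpret A: bounded_linear "cop_apply A" by (rule bounded_linear_cop_apply)
  assume "psd A"
  then have *: "0 \<le> x \<bullet> A x" "x \<bullet> (\<i> *\<^sub>C A x) = 0" for x
    using Im_cinner[of x "A x"]
    by (auto simp: psd_def complex_nonneg_Reals_iff Re_cinner)
  have im: "x \<bullet> (\<i> *\<^sub>C A y) + y \<bullet> (\<i> *\<^sub>C A x) = 0" for x y
    using *(2)[of "x + y"] by (simp add: A.add scaleC_add_right inner_simps *)
  have "A x \<bullet> y = x \<bullet> A y" for x y
  proof -
    have "\<i> *\<^sub>C (\<i> *\<^sub>C A y) = - A y"
      using scaleC_of_real[of "-1" "A y"] by (simp add: scaleC_scaleC)
    then show ?thesis
      using im[of x "\<i> *\<^sub>C y"]
      by (simp add: cop_apply_scaleC inner_scaleC_left scaleC_scaleC inner_simps)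
        (use scaleC_of_real[of 1 "A x"] in \<open>simp add: inner_commute\<close>)
  qed
  with * show "(\<forall>x y. A x \<bullet> y = x \<bullet> A y) \<and> (\<forall>x. 0 \<le> x \<bullet> A x)" by blast
next
  assume A: "(\<forall>x y. A x \<bullet> y = x \<bullet> A y) \<and> (\<forall>x. 0 \<le> x \<bullet> A x)"
  have "x \<bullet> (\<i> *\<^sub>C A x) = 0" for x
  proof -
    have "x \<bullet> (\<i> *\<^sub>C A x) = A x \<bullet> (\<i> *\<^sub>C x)"
      using A by (metis cop_apply_scaleC)
    also have "\<dots> = - (x \<bullet> (\<i> *\<^sub>C A x))"
      using scaleC_scaleR_commute[of \<i> "-1" "A x"] scaleC_of_real[of "-1" "\<i> *\<^sub>C A x"]
      by (simp add: inner_commute[of "A x"] inner_scaleC_left scaleC_scaleC inner_simps)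
    finally show ?thesis by simp
  qed
  with A show "psd A"
    by (auto simp: psd_def complex_nonneg_Reals_iff Re_cinner Im_cinner)
qed

section \<open>The positive square root\<close>

text \<open>
  The Taylor coefficients of \<open>sqrt (1 - z)\<close> at \<open>0\<close>.
\<close>

definition sqrt_coeff :: "nat \<Rightarrow> real"
  where "sqrt_coeff n = (1/2 gchoose n) * (-1) ^ n"

lemma neg_half_gbinomial_sign: "0 \<le> (-1) ^ n * ((-1/2 :: real) gchoose n)"
proof -
  have "(-1/2 :: real) gchoose n = (-1) ^ n * ((1/2 + of_nat n - 1) gchoose n)"
    using gbinomial_minus[of "1/2 :: real" n] by simp
  moreover have "0 \<le> ((1/2 + of_nat n - 1 :: real) gchoose n)"
    unfolding gbinomial_prod_rev by (intro divide_nonneg_nonneg prod_nonneg) auto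
  ultimately show ?thesis by (simp flip: mult.assoc power_add)
qed

lemma sqrt_coeff_0 [simp]: "sqrt_coeff 0 = 1"
  by (simp add: sqrt_coeff_def)

lemma sqrt_coeff_nonpos: "n > 0 \<Longrightarrow> sqrt_coeff n \<le> 0"
proof (cases n)
  case (Suc k)
  have "sqrt_coeff n = - (1/2 / real (Suc k)) * ((-1) ^ k * ((-1/2) gchoose k))"
    using gbinomial_absorption'[of n "1/2 :: real"] by (simp add: sqrt_coeff_def Suc)
  also have "\<dots> \<le> 0" using neg_half_gbinomial_sign[of k] by (intro mult_nonpos_nonneg) auto
  finally show ?thesis .
qed auto

text \<open>
  The partial sums telescope to \<open>(-1)\<^sup>n (-1/2 gchoose n)\<close>. As all coefficients but the first are
  nonpositive, this one inequality gives both absolute summability of the coefficients, hence convergence of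
  the operator series on the closed unit ball, and positivity of its sum.
\<close>

lemma sum_sqrt_coeff_nonneg: "0 \<le> (\<Sum>k\<le>n. sqrt_coeff k)"
  using gbinomial_sum_lower_neg[of "1/2 :: real" n] neg_half_gbinomial_sign[of n]
  by (simp add: sqrt_coeff_def)

lemma summable_abs_sqrt_coeff: "summable (\<lambda>n. \<bar>sqrt_coeff n\<bar>)"
proof (rule summableI_nonneg_bounded)
  fix n
  have *: "\<bar>sqrt_coeff k\<bar> = (if k = 0 then 2 else 0) - sqrt_coeff k" for k
    using sqrt_coeff_nonpos[of k] by auto
  have "(\<Sum>k<n. \<bar>sqrt_coeff k\<bar>) \<le> (\<Sum>k\<le>n. \<bar>sqrt_coeff k\<bar>)"
    by (intro sum_mono2) auto
  also have "\<dots> = 2 - (\<Sum>k\<le>n. sqrt_coeff k)"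
    by (simp add: * sum_subtractf)
  finally show "(\<Sum>k<n. \<bar>sqrt_coeff k\<bar>) \<le> 2"
    using sum_sqrt_coeff_nonneg[of n] by linarith
qed auto

text \<open>
  Vandermonde's identity for \<open>1/2 + 1/2 = 1\<close>.
\<close>

lemma sqrt_coeff_convolution:
  "(\<Sum>i\<le>n. sqrt_coeff i * sqrt_coeff (n - i)) = (if n = 0 then 1 else if n = 1 then -1 else 0)"
proof -
  have "(\<Sum>i\<le>n. sqrt_coeff i * sqrt_coeff (n - i)) =
      (\<Sum>i\<le>n. (-1) ^ n * ((1/2 gchoose i) * (1/2 gchoose (n - i))))"
    by (intro sum.cong) (auto simp: sqrt_coeff_def simp flip: power_add)
  also have "\<dots> = (-1) ^ n * (1 gchoose n)"
    using gbinomial_Vandermonde[of "1/2 :: real" "1/2" n]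
    by (simp add: atLeast0AtMost flip: sum_distrib_left)
  also have "(1 :: real) gchoose n = of_nat (1 choose n)"
    using binomial_gbinomial[of 1 n, where ?'a = real] by simp
  finally show ?thesis by (cases "n \<ge> 2") (auto simp: less_Suc_eq numeral_2_eq_2 not_le)
qed

lemma norm_power_le_1:
  fixes X :: "'a::real_normed_algebra_1"
  assumes "norm X \<le> 1"
  shows "norm (X ^ n) \<le> 1"
  using norm_power_ineq[of X n] power_le_one[of "norm X" n] assms by simp

lemma summable_sqrt_series:
  fixes X :: "'a::{real_normed_algebra_1,banach}"
  assumes "norm X \<le> 1"
  shows "summable (\<lambda>n. norm (sqrt_coeff n *\<^sub>R X ^ n))"
proof (rule summable_comparison_test'[OF summable_abs_sqrt_coeff])
  show "norm (norm (sqrt_coeff n *\<^sub>R X ^ n)) \<le> \<bar>sqrt_coeff n\<bar>" for n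
    using norm_power_le_1[OF assms, of n] by (simp add: mult_left_le)
qed

lemma sqrt_series_square:
  fixes X :: "'a::{real_normed_algebra_1,banach}"
  assumes X: "norm X \<le> 1"
  defines "T \<equiv> \<Sum>n. sqrt_coeff n *\<^sub>R X ^ n"
  shows "T * T = 1 - X"
proof -
  let ?f = "\<lambda>n. \<Sum>i\<le>n. (sqrt_coeff i *\<^sub>R X ^ i) * (sqrt_coeff (n - i) *\<^sub>R X ^ (n - i))"
  have eq: "?f n = (if n = 0 then 1 else if n = 1 then -1 else 0) *\<^sub>R X ^ n" for n
  proof -
    have "?f n = (\<Sum>i\<le>n. (sqrt_coeff i * sqrt_coeff (n - i)) *\<^sub>R X ^ n)"
      by (intro sum.cong) (auto simp: mult.commute simp flip: power_add)
    then show ?thesis by (simp only: sqrt_coeff_convolution flip: scaleR_sum_left)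
  qed
  have "?f sums (T * T)"
    unfolding T_def by (rule Cauchy_product_sums[OF summable_sqrt_series[OF X] summable_sqrt_series[OF X]])
  moreover have "?f sums (\<Sum>n\<in>{0, 1}. ?f n)"
    by (rule sums_finite) (simp_all only: eq, auto)
  ultimately have "T * T = (\<Sum>n\<in>{0, 1}. ?f n)" by (rule sums_unique2)
  then show ?thesis unfolding eq by simp
qed

lemma norm_cop_le: "0 \<le> b \<Longrightarrow> (\<And>x. norm (cop_apply A x) \<le> b * norm x) \<Longrightarrow> norm A \<le> b"
  by transfer (rule norm_blinfun_bound)

lemma psd_symmetric: "psd A \<Longrightarrow> cop_apply A x \<bullet> y = x \<bullet> cop_apply A y"
  by (simp add: psd_iff)

lemma psd_nonneg: "psd A \<Longrightarrow> 0 \<le> x \<bullet> cop_apply A x"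
  by (simp add: psd_iff)

lemma symmetric_power:
  assumes "\<And>x y. cop_apply X x \<bullet> y = x \<bullet> cop_apply X y"
  shows "cop_apply (X ^ n) x \<bullet> y = x \<bullet> cop_apply (X ^ n) y"
proof (induction n arbitrary: x y)
  case (Suc n)
  have "cop_apply (X ^ Suc n) x \<bullet> y = cop_apply (X ^ n) x \<bullet> cop_apply X y"
    by (simp add: assms)
  also have "\<dots> = x \<bullet> cop_apply (X ^ n * X) y" by (simp add: Suc.IH)
  also have "X ^ n * X = X ^ Suc n" by (simp add: power_commutes)
  finally show ?case .
qed auto

text \<open>
  Obtained by testing positivity at \<open>x - A x / norm A\<close>.
\<close>

lemma norm_psd_apply:
  assumes A: "psd A"
  shows "(norm (cop_apply A x))\<^sup>2 \<le> norm A * (x \<bullet> cop_apply A x)"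
proof (cases "norm A = 0")
  case True
  then show ?thesis using norm_cop_apply[of A x] by simp
next
  case False
  interpret A: bounded_linear "cop_apply A" by (rule bounded_linear_cop_apply)
  define s where "s = inverse (norm A)"
  have s: "s * norm A = 1" "s > 0" using False by (auto simp: s_def)
  let ?a = "cop_apply A x"
  have "?a \<bullet> cop_apply A ?a \<le> norm ?a * (norm A * norm ?a)"
    by (rule order_trans[OF norm_cauchy_schwarz]) (simp add: mult_left_mono norm_cop_apply)
  then have "s * (?a \<bullet> cop_apply A ?a) \<le> s * (norm A * (norm ?a)\<^sup>2)"
    using s by (intro mult_left_mono) (auto simp: power2_eq_square algebra_simps)
  also have "\<dots> = (norm ?a)\<^sup>2" by (simp only: mult.assoc[symmetric] s mult_1)
  finally have 1: "s * (s * (?a \<bullet> cop_apply A ?a)) \<le> s * (norm ?a)\<^sup>2"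
    using s by (intro mult_left_mono) auto
  have "0 \<le> (x - s *\<^sub>R ?a) \<bullet> cop_apply A (x - s *\<^sub>R ?a)" by (rule psd_nonneg[OF A])
  also have "\<dots> = x \<bullet> ?a - 2 * (s * (norm ?a)\<^sup>2) + s * (s * (?a \<bullet> cop_apply A ?a))"
    using psd_symmetric[OF A, of x ?a]
    by (simp add: A.diff A.scaleR inner_simps power2_norm_eq_inner inner_commute right_diff_distrib)
  finally have "s * (norm ?a)\<^sup>2 \<le> x \<bullet> ?a" using 1 by linarith
  then have "norm A * (s * (norm ?a)\<^sup>2) \<le> norm A * (x \<bullet> ?a)" by (simp add: mult_left_mono)
  also have "norm A * (s * (norm ?a)\<^sup>2) = (s * norm A) * (norm ?a)\<^sup>2" by simp
  finally show ?thesis by (simp add: s)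
qed

lemma norm_one_minus_psd:
  assumes A: "psd A" and "norm A \<le> 1"
  shows "norm (1 - A) \<le> 1"
proof (rule norm_cop_le)
  fix x
  have "(norm (cop_apply (1 - A) x))\<^sup>2 = (norm x)\<^sup>2 - 2 * (x \<bullet> cop_apply A x) + (norm (cop_apply A x))\<^sup>2"
    by (simp add: power2_norm_eq_inner inner_simps inner_commute)
  also have "\<dots> \<le> (norm x)\<^sup>2"
    using norm_psd_apply[OF A, of x] psd_nonneg[OF A, of x]
      mult_right_mono[OF assms(2) psd_nonneg[OF A, of x]] by linarith
  finally have "norm (cop_apply (1 - A) x) \<le> norm x" by (rule power2_le_imp_le) simp
  then show "norm (cop_apply (1 - A) x) \<le> 1 * norm x" by simp
qed simp

lemma psd_sqrt_series:
  fixes X :: "'a::nonzero_complex_hilbert cop"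
  assumes X: "norm X \<le> 1" and sym: "\<And>x y. X x \<bullet> y = x \<bullet> X y"
  shows "psd (\<Sum>n. sqrt_coeff n *\<^sub>R X ^ n)" (is "psd ?T")
proof -
  have sums: "(\<lambda>n. x \<bullet> (sqrt_coeff n *\<^sub>R X ^ n) y) sums (x \<bullet> ?T y)" for x y
    by (intro bounded_linear.sums[OF bounded_linear_compose[OF bounded_linear_inner_right
            bounded_linear_cop_eval]]
        summable_sums summable_norm_cancel[OF summable_sqrt_series[OF X]])
  have sym': "?T x \<bullet> y = x \<bullet> ?T y" for x y
  proof -
    have "x \<bullet> (sqrt_coeff n *\<^sub>R X ^ n) y = y \<bullet> (sqrt_coeff n *\<^sub>R X ^ n) x" for n
      using symmetric_power[OF sym, of n x y] by (simp add: inner_commute)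
    then have "(\<lambda>n. y \<bullet> (sqrt_coeff n *\<^sub>R X ^ n) x) sums (x \<bullet> ?T y)"
      using sums[of x y] by (simp only:)
    with sums[of y x] have "y \<bullet> ?T x = x \<bullet> ?T y" by (rule sums_unique2)
    then show ?thesis by (simp add: inner_commute)
  qed
  have "0 \<le> x \<bullet> ?T x" for x
  proof (rule LIMSEQ_le_const)
    show "(\<lambda>n. \<Sum>k<n. x \<bullet> (sqrt_coeff k *\<^sub>R X ^ k) x) \<longlonglongrightarrow> x \<bullet> ?T x"
      using sums[of x x] by (simp add: sums_def)
    have "0 \<le> (\<Sum>k<Suc n. x \<bullet> (sqrt_coeff k *\<^sub>R X ^ k) x)" for n
    proof -
      \<comment> \<open>Only the first coefficient is positive, and there both sides agree.\<close>
      have "sqrt_coeff k * (norm x)\<^sup>2 \<le> sqrt_coeff k * (x \<bullet> (X ^ k) x)" for k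
      proof (cases "k = 0")
        case False
        have "x \<bullet> (X ^ k) x \<le> norm x * (norm (X ^ k) * norm x)"
          by (rule order_trans[OF norm_cauchy_schwarz]) (simp add: mult_left_mono norm_cop_apply)
        also have "\<dots> = norm (X ^ k) * (norm x)\<^sup>2" by (simp add: power2_eq_square)
        also have "\<dots> \<le> (norm x)\<^sup>2"
          using norm_power_le_1[OF X, of k] by (simp add: mult_left_le_one_le)
        finally show ?thesis using sqrt_coeff_nonpos[of k] False by (simp add: mult_left_mono_neg)
      qed (simp add: power2_norm_eq_inner)
      then have "(\<Sum>k\<le>n. sqrt_coeff k * (norm x)\<^sup>2) \<le> (\<Sum>k\<le>n. sqrt_coeff k * (x \<bullet> (X ^ k) x))"
        by (intro sum_mono)
      moreover have "0 \<le> (\<Sum>k\<le>n. sqrt_coeff k * (norm x)\<^sup>2)"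
        unfolding sum_distrib_right[symmetric] by (simp add: sum_sqrt_coeff_nonneg)
      ultimately show ?thesis by (simp add: lessThan_Suc_atMost)
    qed
    then show "\<exists>N. \<forall>n\<ge>N. 0 \<le> (\<Sum>k<n. x \<bullet> (sqrt_coeff k *\<^sub>R X ^ k) x)"
      by (intro exI[of _ 1]) (metis Suc_le_D One_nat_def)
  qed
  with sym' show ?thesis by (simp add: psd_iff)
qed

lemma psd_scaleR: "psd A \<Longrightarrow> 0 \<le> r \<Longrightarrow> psd (r *\<^sub>R A)"
  by (simp add: psd_iff)

text \<open>
  Rescaling \<open>A\<close> to norm at most \<open>1\<close> puts \<open>1 - A\<close> into the closed unit ball, where the binomial series
  converges. That the root commutes with the commutant of \<open>A\<close> is what uniqueness rests on.
\<close>

lemma ex_psd_sqrt: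
  fixes A :: "'a::nonzero_complex_hilbert cop"
  assumes A: "psd A"
  shows "\<exists>S. psd S \<and> S * S = A \<and> (\<forall>C. C * A = A * C \<longrightarrow> C * S = S * C)"
proof -
  \<comment> \<open>The summand \<open>1\<close> keeps \<open>M\<close> positive when \<open>A = 0\<close>.\<close>
  define M where "M = norm A + 1"
  have M: "M > 0" "norm A \<le> M" unfolding M_def using norm_ge_zero[of A] by linarith+
  define X where "X = 1 - inverse M *\<^sub>R A"
  define T where "T = (\<Sum>n. sqrt_coeff n *\<^sub>R X ^ n)"
  have X: "norm X \<le> 1" unfolding X_def
    by (rule norm_one_minus_psd) (use A M in \<open>auto intro!: psd_scaleR simp: divide_simps\<close>)
  have "X x \<bullet> y = x \<bullet> X y" for x y
    by (simp add: X_def inner_simps psd_symmetric[OF A])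
  then have "psd T" unfolding T_def by (intro psd_sqrt_series X)
  have "T * T = inverse M *\<^sub>R A"
    unfolding T_def using sqrt_series_square[OF X] by (simp add: X_def)
  then have square: "(sqrt M *\<^sub>R T) * (sqrt M *\<^sub>R T) = A"
    using M by (simp flip: mult.assoc)
  have comm: "C * (sqrt M *\<^sub>R T) = (sqrt M *\<^sub>R T) * C" if C: "C * A = A * C" for C
  proof -
    have "X * C = C * X" by (simp add: X_def left_diff_distrib right_diff_distrib C)
    then have pow: "X ^ n * C = C * X ^ n" for n
      by (rule power_commuting_commutes)
    have T: "(\<lambda>n. sqrt_coeff n *\<^sub>R X ^ n) sums T"
      unfolding T_def
      by (intro summable_sums summable_norm_cancel[OF summable_sqrt_series[OF X]])
    have "(\<lambda>n. C * (sqrt_coeff n *\<^sub>R X ^ n)) sums (T * C)"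
      using sums_mult2[OF T, of C] by (simp add: pow)
    with sums_mult[OF T, of C] have "C * T = T * C" by (rule sums_unique2)
    then show ?thesis by simp
  qed
  have "psd (sqrt M *\<^sub>R T)" using \<open>psd T\<close> M by (simp add: psd_scaleR)
  with square comm show ?thesis by blast
qed

text \<open>
  Uniqueness: another positive root \<open>T\<close> commutes with \<open>T * T = A\<close>, hence with the constructed root \<open>S\<close>,
  so \<open>(T + S) * (T - S) = 0\<close>. For \<open>y = (T - S) x\<close> both \<open>y \<bullet> T y\<close> and \<open>y \<bullet> S y\<close> then vanish, which forces
  \<open>T y = S y = 0\<close> and finally \<open>y = 0\<close>.
\<close>

lemma sqrt_cop:
  fixes A :: "'a::nonzero_complex_hilbert cop"
  assumes A: "psd A"
  shows "psd (sqrt_cop A)" and "sqrt_cop A * sqrt_cop A = A"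
proof -
  obtain S where S: "psd S" "S * S = A" and comm: "\<And>C. C * A = A * C \<Longrightarrow> C * S = S * C"
    using ex_psd_sqrt[OF A] by blast
  have "sqrt_cop A = S" unfolding sqrt_cop_def
  proof (rule the_equality)
    fix T assume T: "psd T \<and> T * T = A"
    have ST: "T * S = S * T" by (rule comm) (metis T mult.assoc)
    show "T = S"
    proof (rule cop_eqI)
      fix x
      interpret S: bounded_linear "cop_apply S" by (rule bounded_linear_cop_apply)
      interpret T: bounded_linear "cop_apply T" by (rule bounded_linear_cop_apply)
      define y where "y = (T - S) x"
      have "(T + S) * (T - S) = 0" using T S ST by (simp add: algebra_simps)
      then have "y \<bullet> T y + y \<bullet> S y = 0"
        by (metis cop_apply_algebra(1) cop_apply_algebra(2) cop_apply_mult(1) diff_self inner_add_right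
            inner_zero_right y_def)
      then have "y \<bullet> T y = 0" "y \<bullet> S y = 0"
        using psd_nonneg[of T y] psd_nonneg[of S y] T S by linarith+
      then have "T y = 0" "S y = 0"
        using norm_psd_apply[of T y] norm_psd_apply[of S y] T S by auto
      then have "(T - S) y = 0" by simp
      moreover have "y \<bullet> y = x \<bullet> (T - S) y"
        unfolding y_def using T S
        by (simp add: inner_simps psd_symmetric T.diff S.diff)
      ultimately have "y = 0" by simp
      then show "T x = S x" by (simp add: y_def)
    qed
  qed (use S in auto)
  with S show "psd (sqrt_cop A)" "sqrt_cop A * sqrt_cop A = A" by auto
qed

section \<open>Shifted Legendre polynomials\<close>

lemma has_integral_pderiv:
  fixes p :: "real poly"
  shows "(poly (pderiv p) has_integral poly p 1 - poly p 0) {0..1}"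
  by (rule fundamental_theorem_of_calculus)
    (auto intro: has_field_derivative_at_within poly_DERIV
      simp flip: has_real_derivative_iff_has_vector_derivative)

lemma integrable_poly: "poly (p :: real poly) integrable_on {0..1}"
  by (intro integrable_continuous_real continuous_intros)

lemma integral_pderiv_mult:
  fixes p q :: "real poly"
  shows "integral {0..1} (poly (pderiv p * q)) =
    poly (p * q) 1 - poly (p * q) 0 - integral {0..1} (poly (p * pderiv q))"
proof -
  have "poly (p * q) 1 - poly (p * q) 0 = integral {0..1} (poly (pderiv (p * q)))"
    using integral_unique[OF has_integral_pderiv] by simp
  also have "poly (pderiv (p * q)) = (\<lambda>u. poly (p * pderiv q) u + poly (pderiv p * q) u)"
    by (simp add: pderiv_mult fun_eq_iff algebra_simps)
  also have "integral {0..1} \<dots> =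
      integral {0..1} (poly (p * pderiv q)) + integral {0..1} (poly (pderiv p * q))"
    by (intro integral_add integrable_poly)
  finally show ?thesis by simp
qed

lemma linear_power_dvd_pderiv:
  fixes p :: "'a::idom poly"
  assumes "[:a, 1:] ^ Suc n dvd p"
  shows "[:a, 1:] ^ n dvd pderiv p"
proof -
  obtain q where "p = [:a, 1:] ^ Suc n * q" using assms by blast
  then have "pderiv p = [:a, 1:] ^ n * ([:a, 1:] * pderiv q + smult (of_nat (Suc n)) (pderiv [:a, 1:] * q))"
    by (simp only: pderiv_mult pderiv_power_Suc) (simp add: algebra_simps)
  then show ?thesis by simp
qed

lemma linear_power_dvd_higher_pderiv:
  fixes p :: "'a::idom poly"
  shows "[:a, 1:] ^ (n + k) dvd p \<Longrightarrow> [:a, 1:] ^ n dvd (pderiv ^^ k) p"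
  by (induction k arbitrary: n) (auto intro: linear_power_dvd_pderiv simp del: power_Suc)

definition legendre_kernel :: "nat \<Rightarrow> real poly"
  where "legendre_kernel m = [:0, 1:] ^ m * [:-1, 1:] ^ m"

lemma higher_pderiv_legendre_kernel:
  assumes "k < m"
  shows "poly ((pderiv ^^ k) (legendre_kernel m)) 0 = 0"
    and "poly ((pderiv ^^ k) (legendre_kernel m)) 1 = 0"
proof -
  obtain n where m: "m = Suc n + k" using assms by (metis add.commute add_Suc_right less_iff_Suc_add)
  have power_dvd: "[:a, 1:] ^ Suc n dvd (pderiv ^^ k) (legendre_kernel m)" if "a = 0 \<or> a = -1" for a :: real
    by (rule linear_power_dvd_higher_pderiv, unfold m[symmetric])
      (use that in \<open>auto simp: legendre_kernel_def\<close>)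
  have "[:a, 1:] dvd (pderiv ^^ k) (legendre_kernel m)" if "a = 0 \<or> a = -1" for a :: real
    by (rule dvd_mult_left[OF power_dvd[OF that, unfolded power_Suc]])
  from this[of 0] this[of "-1"] show "poly ((pderiv ^^ k) (legendre_kernel m)) 0 = 0"
    "poly ((pderiv ^^ k) (legendre_kernel m)) 1 = 0"
    by (simp_all add: poly_eq_0_iff_dvd)
qed

text \<open>
  Repeated integration by parts; the boundary terms vanish because the kernel has zeros of order \<open>m\<close>
  at both end points.
\<close>

lemma integral_higher_pderiv_legendre_kernel:
  "k \<le> m \<Longrightarrow> integral {0..1} (poly ((pderiv ^^ k) (legendre_kernel m) * q)) =
    (-1) ^ k * integral {0..1} (poly (legendre_kernel m * (pderiv ^^ k) q))"
proof (induction k arbitrary: q)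
  case (Suc k)
  have "integral {0..1} (poly ((pderiv ^^ Suc k) (legendre_kernel m) * q)) =
      - integral {0..1} (poly ((pderiv ^^ k) (legendre_kernel m) * pderiv q))"
    using Suc.prems unfolding funpow.simps o_apply integral_pderiv_mult
    by (simp add: higher_pderiv_legendre_kernel)
  also have "\<dots> = - ((-1) ^ k * integral {0..1} (poly (legendre_kernel m * (pderiv ^^ k) (pderiv q))))"
    by (simp only: Suc.IH[OF Suc_leD[OF Suc.prems]])
  finally show ?case
    by (simp only: funpow_swap1 funpow.simps o_apply power_Suc mult_minus_left mult_1_left)
qed simp

lemma integral_beta:
  "integral {0..1} (poly ([:0, 1:] ^ a * [:-1, 1:] ^ b)) =
    (-1) ^ b * fact a * fact b / (fact (a + b + 1) :: real)"
proof (induction b arbitrary: a)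
  case 0
  have "integral {0..1} (poly (pderiv ([:0, 1::real:] ^ Suc a) * 1)) = 1"
  proof -
    have "poly (0 :: real poly) = (\<lambda>_. 0)" by (rule ext) simp
    then show ?thesis unfolding integral_pderiv_mult by simp
  qed
  also have "poly (pderiv ([:0, 1::real:] ^ Suc a) * 1) = (\<lambda>u. (real a + 1) * poly ([:0, 1:] ^ a) u)"
    by (simp only: pderiv_power_Suc) (simp add: fun_eq_iff algebra_simps pderiv_pCons)
  also have "integral {0..1} \<dots> = (real a + 1) * integral {0..1} (poly ([:0, 1:] ^ a))"
    by (rule integral_mult_right)
  finally have "integral {0..1} (poly ([:0, 1::real:] ^ a)) = 1 / (real a + 1)"
    by (simp add: eq_divide_eq mult.commute)
  moreover have "fact (a + 0 + 1) = (real a + 1) * fact a" by (simp add: algebra_simps)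
  ultimately show ?case by (simp only: power_0 mult_1_right fact_0) simp
next
  case (Suc b)
  have "poly (pderiv ([:0, 1::real:] ^ Suc a) * [:-1, 1:] ^ Suc b) =
      (\<lambda>u. (real a + 1) * poly ([:0, 1:] ^ a * [:-1, 1:] ^ Suc b) u)"
    by (simp only: pderiv_power_Suc) (simp add: fun_eq_iff algebra_simps pderiv_pCons)
  then have "(real a + 1) * integral {0..1} (poly ([:0, 1:] ^ a * [:-1, 1:] ^ Suc b)) =
      integral {0..1} (poly (pderiv ([:0, 1::real:] ^ Suc a) * [:-1, 1:] ^ Suc b))"
    by (simp only: integral_mult_right)
  also have "\<dots> = - integral {0..1} (poly ([:0, 1::real:] ^ Suc a * pderiv ([:-1, 1:] ^ Suc b)))"
    unfolding integral_pderiv_mult by simp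
  also have "poly ([:0, 1::real:] ^ Suc a * pderiv ([:-1, 1:] ^ Suc b)) =
      (\<lambda>u. (real b + 1) * poly ([:0, 1::real:] ^ Suc a * [:-1, 1:] ^ b) u)"
    by (simp only: pderiv_power_Suc) (simp add: fun_eq_iff algebra_simps pderiv_pCons)
  also have "- integral {0..1} \<dots> = - ((real b + 1) * ((-1) ^ b * fact (Suc a) * fact b / fact (Suc a + b + 1)))"
    unfolding integral_mult_right Suc.IH ..
  also have "\<dots> = (real a + 1) * ((-1) ^ Suc b * fact a * fact (Suc b) / fact (a + Suc b + 1))"
  proof -
    have fact_Suc': "fact (Suc k) = (real k + 1) * fact k" for k by (simp add: algebra_simps)
    have "Suc a + b + 1 = a + Suc b + 1" by simp
    then show ?thesis by (simp only: fact_Suc'[of a] fact_Suc'[of b] power_Suc) simp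
  qed
  finally have "(real a + 1) * integral {0..1} (poly ([:0, 1:] ^ a * [:-1, 1:] ^ Suc b)) =
      (real a + 1) * ((-1) ^ Suc b * fact a * fact (Suc b) / fact (a + Suc b + 1))" .
  moreover have "real a + 1 \<noteq> 0" by linarith
  ultimately show ?case by (rule mult_left_cancel[THEN iffD1, rotated])
qed

text \<open>
  The Rodrigues formula, normalised to leading coefficient \<open>1\<close>.
\<close>

definition legendre :: "nat \<Rightarrow> real poly"
  where "legendre m = smult (fact m / fact (2 * m)) ((pderiv ^^ m) (legendre_kernel m))"

text \<open>
  The integral of the square of \<open>legendre m\<close> over \<open>[0, 1]\<close>.
\<close>

definition legendre_norm2 :: "nat \<Rightarrow> real"
  where "legendre_norm2 m = (fact m) ^ 4 / (fact (2 * m) * fact (2 * m + 1))"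

lemma legendre_norm2_pos: "0 < legendre_norm2 m"
  by (simp add: legendre_norm2_def)

lemma degree_legendre_kernel: "degree (legendre_kernel m) = 2 * m"
  by (simp add: legendre_kernel_def degree_mult_eq degree_power_eq)

lemma lead_coeff_legendre_kernel: "coeff (legendre_kernel m) (2 * m) = 1"
proof -
  have "lead_coeff (legendre_kernel m) = 1"
    by (simp add: legendre_kernel_def lead_coeff_mult lead_coeff_power)
  then show ?thesis by (simp add: degree_legendre_kernel)
qed

lemma degree_legendre: "degree (legendre m) \<le> m"
  using degree_smult_le[of _ "(pderiv ^^ m) (legendre_kernel m)"]
  by (simp add: legendre_def degree_higher_pderiv degree_legendre_kernel)

lemma coeff_legendre: "coeff (legendre m) m = 1"
proof -
  have "fact m * pochhammer (real (Suc m)) m = (fact (2 * m) :: real)"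
    using pochhammer_product'[of "1 :: real" m m]
    by (simp add: pochhammer_fact mult_2 add.commute)
  then show ?thesis
    using lead_coeff_legendre_kernel[of m]
    by (simp add: legendre_def coeff_higher_pderiv field_simps flip: mult_2)
qed

lemma higher_pderiv_degree_le:
  fixes q :: "real poly"
  assumes "degree q \<le> m"
  shows "(pderiv ^^ m) q = [:fact m * coeff q m:]"
proof (rule poly_eqI)
  fix k
  show "coeff ((pderiv ^^ m) q) k = coeff [:fact m * coeff q m:] k"
    using assms
    by (cases k) (auto simp: coeff_higher_pderiv pochhammer_fact coeff_eq_0)
qed

text \<open>
  Integrating by parts \<open>m\<close> times moves all derivatives to \<open>q\<close>, where only the coefficient of order \<open>m\<close> survives;
  what remains is a Beta integral.
\<close>

lemma legendre_orthogonal: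
  assumes "degree q \<le> m"
  shows "((\<lambda>u. poly (legendre m) u * poly q u) has_integral legendre_norm2 m * coeff q m) {0..1}"
proof -
  have "integral {0..1} (\<lambda>u. poly (legendre m) u * poly q u) =
      fact m / fact (2 * m) * integral {0..1} (poly ((pderiv ^^ m) (legendre_kernel m) * q))"
    by (simp add: legendre_def mult.assoc flip: integral_mult_right)
  also have "\<dots> = fact m / fact (2 * m) *
      ((-1) ^ m * (fact m * coeff q m * integral {0..1} (poly (legendre_kernel m))))"
    unfolding integral_higher_pderiv_legendre_kernel[OF order_refl] higher_pderiv_degree_le[OF assms]
    by (simp add: mult.assoc mult.left_commute flip: integral_mult_right)
  also have "integral {0..1} (poly (legendre_kernel m)) = (-1) ^ m * fact m * fact m / fact (m + m + 1)"
    unfolding legendre_kernel_def by (rule integral_beta)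
  finally have closed_form: "integral {0..1} (\<lambda>u. poly (legendre m) u * poly q u) =
      fact m / fact (2 * m) * ((-1) ^ m * (fact m * coeff q m *
        ((-1) ^ m * fact m * fact m / fact (m + m + 1))))" .
  have "integral {0..1} (\<lambda>u. poly (legendre m) u * poly q u) = legendre_norm2 m * coeff q m"
  proof -
    have regroup: "a / b * (s * (a * x * (s * a * a / c))) = (s * s) * (a ^ 4 / (b * c)) * x"
      for a b c s x :: real
      by (simp add: power4_eq_xxxx)
    have "(-1 :: real) ^ m * (-1) ^ m = 1" by (simp flip: power_add)
    then show ?thesis
      unfolding closed_form legendre_norm2_def regroup by (simp only: mult_1 mult_2)
  qed
  moreover have "poly (legendre m * q) = (\<lambda>u. poly (legendre m) u * poly q u)"
    by (rule ext) simp
  ultimately show ?thesis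
    using integrable_integral[OF integrable_poly[of "legendre m * q"]] by (simp only:)
qed

text \<open>
  The factor \<open>(fact m)\<^sup>2\<close> comes from the coefficient of order \<open>m\<close> in the exponential series.
\<close>

definition decay_const :: "nat \<Rightarrow> real"
  where "decay_const m = legendre_norm2 m / (fact m)\<^sup>2"

lemma legendre_bounded: "\<exists>M\<ge>0. \<forall>u\<in>{0..1}. \<bar>poly (legendre m) u\<bar> \<le> M"
proof -
  have "compact (poly (legendre m) ` {0..1})"
    by (intro compact_continuous_image continuous_intros compact_Icc)
  then obtain M where "\<forall>v\<in>poly (legendre m) ` {0..1}. norm v \<le> M"
    using compact_imp_bounded bounded_iff by metis
  then show ?thesis by (intro exI[of _ "\<bar>M\<bar>"]) force
qed

lemma legendre_square_has_integral:
  "((\<lambda>u. (poly (legendre m) u)\<^sup>2) has_integral legendre_norm2 m) {0..1}"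
  using legendre_orthogonal[OF degree_legendre, of m] by (simp add: coeff_legendre power2_eq_square)

lemma decay_const_pos: "decay_const m > 0"
  by (simp add: decay_const_def legendre_norm2_pos)

section \<open>Operator estimates\<close>

lemma cop_apply_sum: "cop_apply (\<Sum>i\<in>I. A i) x = (\<Sum>i\<in>I. cop_apply (A i) x)"
  by (rule bounded_linear.linear[OF bounded_linear_cop_eval, THEN linear_sum])

lemma cop_apply_uminus [simp]: "cop_apply (- A) x = - cop_apply A x"
  by transfer (simp add: blinfun.minus_left)

lemma ex_unit_vector: "\<exists>x :: 'a::nonzero_complex_hilbert. norm x = 1"
proof -
  obtain x :: 'a where "x \<noteq> 0" using ex_nonzero by blast
  then show ?thesis by (intro exI[of _ "x /\<^sub>R norm x"]) simp
qed

lemma norm_cop_power2_le: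
  fixes A :: "'a::nonzero_complex_hilbert cop"
  assumes "\<And>x. norm x = 1 \<Longrightarrow> (norm (A x))\<^sup>2 \<le> b"
  shows "(norm A)\<^sup>2 \<le> b"
proof -
  obtain e :: 'a where "norm e = 1" using ex_unit_vector by blast
  then have b: "0 \<le> b" using assms[of e] by (meson order_trans zero_le_power2)
  have "norm A \<le> sqrt b"
  proof (rule norm_cop_le)
    fix x
    interpret A: bounded_linear "cop_apply A" by (rule bounded_linear_cop_apply)
    show "norm (A x) \<le> sqrt b * norm x"
    proof (cases "x = 0")
      case False
      have "norm (A (x /\<^sub>R norm x)) \<le> sqrt b"
        by (rule real_le_rsqrt, rule assms) (use False in simp)
      then show ?thesis using False by (simp add: A.scaleR field_simps)
    qed (simp add: A.zero)
  qed (simp add: b)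
  then have "(norm A)\<^sup>2 \<le> (sqrt b)\<^sup>2" by (intro power_mono) auto
  then show ?thesis using b by simp
qed

lemma norm_power_cop_apply:
  fixes A :: "'a::nonzero_complex_hilbert cop"
  shows "norm ((A ^ n) x) \<le> norm A ^ n * norm x"
  by (rule order_trans[OF norm_cop_apply]) (simp add: mult_right_mono norm_power_ineq)

text \<open>
  Uses \<open>k! n! \<le> (k + n)!\<close> termwise. The factor \<open>1 / n!\<close> makes the remainder vanish
  for \<open>n\<close> tending to infinity however large \<open>A\<close> is.
\<close>

lemma norm_exp_taylor_remainder:
  fixes A :: "'a::{real_normed_algebra_1,banach}"
  shows "norm (exp A - (\<Sum>j<n. A ^ j /\<^sub>R fact j)) \<le> norm A ^ n / fact n * exp (norm A)"
proof -
  have "exp A - (\<Sum>j<n. A ^ j /\<^sub>R fact j) = (\<Sum>k. A ^ (k + n) /\<^sub>R fact (k + n))"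
    using exp_first_terms[of A n] by simp
  also have "norm \<dots> \<le> (\<Sum>k. norm A ^ n / fact n * (norm A ^ k /\<^sub>R fact k))"
  proof (rule norm_suminf_le)
    fix k
    have "fact k * fact n \<le> (fact (k + n) :: real)"
      using dvd_imp_le[OF fact_fact_dvd_fact[of k n]]
      by (simp add: of_nat_le_iff[where ?'a = real, symmetric] del: of_nat_le_iff)
    then have "norm (A ^ (k + n)) / fact (k + n) \<le> norm A ^ (k + n) / (fact k * fact n)"
      by (intro frac_le) (auto simp: norm_power_ineq)
    then show "norm (A ^ (k + n) /\<^sub>R fact (k + n)) \<le> norm A ^ n / fact n * (norm A ^ k /\<^sub>R fact k)"
      by (simp add: divide_inverse_commute power_add mult_ac)
  qed (intro summable_mult summable_exp_generic)
  also have "\<dots> = norm A ^ n / fact n * exp (norm A)"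
    by (simp only: exp_def suminf_mult[OF summable_exp_generic])
  finally show ?thesis .
qed

section \<open>Dissipation of the semigroup\<close>

locale accretive =
  fixes B :: "'a::nonzero_complex_hilbert cop"
  assumes psd_herm: "psd (herm B)"
begin

abbreviation S :: "'a cop" where "S \<equiv> sqrt_cop (herm B)"

abbreviation P :: "real \<Rightarrow> 'a cop" where "P t \<equiv> exp (- (t *\<^sub>R B))"

lemma norm_S_power2: "(norm (S x))\<^sup>2 = x \<bullet> B x"
proof -
  have "(norm (S x))\<^sup>2 = x \<bullet> (S * S) x"
    by (simp add: power2_norm_eq_inner psd_symmetric[OF sqrt_cop(1)[OF psd_herm]])
  also have "\<dots> = x \<bullet> B x"
    using cadjoint_inner[of B x x] unfolding sqrt_cop(2)[OF psd_herm]
    by (simp add: herm_def inner_simps inner_commute)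
  finally show ?thesis .
qed

lemma cadjoint_power_inner: "(cadjoint B ^ j) x \<bullet> y = x \<bullet> (B ^ j) y"
proof (induction j arbitrary: x y)
  case (Suc j)
  have "(cadjoint B ^ Suc j) x \<bullet> y = x \<bullet> (B ^ j * B) y"
    by (simp add: cadjoint_inner Suc.IH)
  also have "B ^ j * B = B ^ Suc j" by (simp add: power_commutes)
  finally show ?case .
qed simp

text \<open>
  The quadratic form of the sum in the index condition is the sum of squared norms of the observations.
\<close>

lemma hc_condition_iff:
  "hc_condition B m \<longleftrightarrow> (\<exists>\<kappa>>0. \<forall>x. \<kappa> * (norm x)\<^sup>2 \<le> (\<Sum>j\<le>m. (norm (S ((B ^ j) x)))\<^sup>2))"
proof -
  have sq: "(norm (S ((B ^ j) x)))\<^sup>2 = x \<bullet> (cadjoint B ^ j) (herm B ((B ^ j) x))" for j x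
  proof -
    have "(norm (S ((B ^ j) x)))\<^sup>2 = (B ^ j) x \<bullet> (S * S) ((B ^ j) x)"
      by (simp add: power2_norm_eq_inner psd_symmetric[OF sqrt_cop(1)[OF psd_herm]])
    then show ?thesis
      using cadjoint_power_inner[of j "herm B ((B ^ j) x)" x]
      by (simp add: sqrt_cop(2)[OF psd_herm] inner_commute)
  qed
  have sym: "(cadjoint B ^ j) (herm B ((B ^ j) x)) \<bullet> y = x \<bullet> (cadjoint B ^ j) (herm B ((B ^ j) y))" for j x y
    using cadjoint_power_inner[of j "herm B ((B ^ j) x)" y] cadjoint_power_inner[of j "herm B ((B ^ j) y)" x]
      psd_symmetric[OF psd_herm, of "(B ^ j) x" "(B ^ j) y"] by (metis inner_commute)
  have "psd ((\<Sum>j\<le>m. cadjoint B ^ j * herm B * B ^ j) - \<kappa> *\<^sub>R 1) \<longleftrightarrow>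
      (\<forall>x. \<kappa> * (norm x)\<^sup>2 \<le> (\<Sum>j\<le>m. (norm (S ((B ^ j) x)))\<^sup>2))" for \<kappa>
    unfolding psd_iff sq
    by (simp add: cop_apply_sum inner_simps inner_sum_left inner_sum_right sym power2_norm_eq_inner)
  then show ?thesis unfolding hc_condition_def by simp
qed

text \<open>
  Normalised so that it equals the mean of \<open>\<parallel>S P s x\<parallel>\<^sup>2\<close> over the time interval \<open>[0, t]\<close>; rescaling time to
  \<open>[0, 1]\<close> keeps the interval of integration fixed as \<open>t\<close> tends to \<open>0\<close>.
\<close>

definition dissipation :: "real \<Rightarrow> 'a \<Rightarrow> real"
  where "dissipation t x = ((norm x)\<^sup>2 - (norm (P t x))\<^sup>2) / (2 * t)"

text \<open>
  The fundamental theorem of calculus for \<open>\<parallel>P (t u) x\<parallel>\<^sup>2\<close>; only the Hermitian part of \<open>B\<close> enters its derivative.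
\<close>

lemma dissipation_has_integral:
  assumes "t > 0"
  shows "((\<lambda>u. (norm (S (P (t * u) x)))\<^sup>2) has_integral dissipation t x) {0..1}"
proof -
  define y where "y u = P (t * u) x" for u
  have P_eq: "P (t * u) = exp (u *\<^sub>R (- (t *\<^sub>R B)))" for u by (simp add: mult.commute)
  have y': "(y has_vector_derivative - t *\<^sub>R B (y u)) (at u within {0..1})" for u
    using bounded_linear.has_vector_derivative[OF bounded_linear_cop_eval
        exp_scaleR_has_vector_derivative_left[of "- (t *\<^sub>R B)" u], of x, THEN has_vector_derivative_at_within]
    unfolding y_def P_eq by simp
  have "((\<lambda>u. y u \<bullet> y u) has_vector_derivative - 2 * t * (norm (S (y u)))\<^sup>2) (at u within {0..1})" for u
  proof -
    have "((\<lambda>u. y u \<bullet> y u) has_vector_derivative (y u \<bullet> (- t *\<^sub>R B (y u)) + (- t *\<^sub>R B (y u)) \<bullet> y u))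
        (at u within {0..1})"
      by (rule bounded_bilinear.has_vector_derivative[OF bounded_bilinear_inner y' y'])
    also have "y u \<bullet> (- t *\<^sub>R B (y u)) + (- t *\<^sub>R B (y u)) \<bullet> y u = - 2 * t * (norm (S (y u)))\<^sup>2"
      by (simp add: norm_S_power2 inner_commute)
    finally show ?thesis .
  qed
  then have "((\<lambda>u. - 2 * t * (norm (S (y u)))\<^sup>2) has_integral (y 1 \<bullet> y 1 - y 0 \<bullet> y 0)) {0..1}"
    by (intro fundamental_theorem_of_calculus) auto
  from has_integral_mult_right[OF this, of "- 1 / (2 * t)"]
  have "((\<lambda>u. (norm (S (y u)))\<^sup>2) has_integral - 1 / (2 * t) * (y 1 \<bullet> y 1 - y 0 \<bullet> y 0)) {0..1}"
    using assms by simp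
  also have "- 1 / (2 * t) * (y 1 \<bullet> y 1 - y 0 \<bullet> y 0) = dissipation t x"
    using assms by (simp add: dissipation_def y_def power2_norm_eq_inner divide_simps)
  finally show ?thesis unfolding y_def .
qed

lemma norm_P_apply_power2: "t > 0 \<Longrightarrow> (norm (P t x))\<^sup>2 = (norm x)\<^sup>2 - 2 * t * dissipation t x"
  by (simp add: dissipation_def)

lemma dissipation_nonneg: "t > 0 \<Longrightarrow> 0 \<le> dissipation t x"
  by (rule has_integral_nonneg[OF dissipation_has_integral]) auto

lemma obs_taylor:
  assumes t: "0 \<le> t" and u: "0 \<le> u" "u \<le> 1"
  shows "norm (S (P (t * u) x) - (\<Sum>j\<le>m. ((- (t * u)) ^ j / fact j) *\<^sub>R S ((B ^ j) x)))
    \<le> norm S * ((t * norm B) ^ Suc m / fact (Suc m) * exp (t * norm B)) * norm x"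
proof -
  interpret S: bounded_linear "cop_apply S" by (rule bounded_linear_cop_apply)
  define A where "A = - ((t * u) *\<^sub>R B)"
  define R where "R = exp A - (\<Sum>j<Suc m. A ^ j /\<^sub>R fact j)"
  have pow: "A ^ j = (- (t * u)) ^ j *\<^sub>R B ^ j" for j
    by (simp add: A_def flip: scaleR_minus_left scaleR_power)
  have "S (P (t * u) x) - (\<Sum>j\<le>m. ((- (t * u)) ^ j / fact j) *\<^sub>R S ((B ^ j) x)) = S (R x)"
    unfolding R_def lessThan_Suc_atMost
    by (simp add: cop_apply_sum pow S.diff S.sum S.scaleR divide_inverse_commute flip: A_def)
  moreover have "norm (S (R x)) \<le> norm S * (norm R * norm x)"
    by (rule order_trans[OF norm_cop_apply]) (simp add: mult_left_mono norm_cop_apply)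
  moreover have R: "norm R \<le> (t * norm B) ^ Suc m / fact (Suc m) * exp (t * norm B)"
  proof -
    have "norm A \<le> t * norm B"
      using t u by (simp add: A_def mult_left_le mult_right_mono)
    have "norm R \<le> norm A ^ Suc m / fact (Suc m) * exp (norm A)"
      unfolding R_def by (rule norm_exp_taylor_remainder)
    also have "\<dots> \<le> (t * norm B) ^ Suc m / fact (Suc m) * exp (t * norm B)"
      using \<open>norm A \<le> t * norm B\<close> t by (intro mult_mono divide_right_mono power_mono) auto
    finally show ?thesis .
  qed
  moreover have "norm S * (norm R * norm x) \<le>
      norm S * ((t * norm B) ^ Suc m / fact (Suc m) * exp (t * norm B) * norm x)"
    by (intro mult_left_mono mult_right_mono R norm_ge_zero)
  ultimately show ?thesis by (simp only: mult.assoc)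
qed

lemma obs_taylor_short_time:
  assumes "0 \<le> t" "t \<le> 1" "0 \<le> u" "u \<le> 1"
  shows "norm (S (P (t * u) x) - (\<Sum>j\<le>m. ((- (t * u)) ^ j / fact j) *\<^sub>R S ((B ^ j) x)))
    \<le> norm S * norm B ^ Suc m * exp (norm B) * t ^ Suc m * norm x"
proof -
  have "(t * norm B) ^ Suc m / fact (Suc m) * exp (t * norm B) \<le> (t * norm B) ^ Suc m * exp (norm B)"
  proof (intro mult_mono)
    show "(t * norm B) ^ Suc m / fact (Suc m) \<le> (t * norm B) ^ Suc m"
      using assms fact_ge_1[of "Suc m", where ?'a = real] divide_left_mono[of 1 "fact (Suc m)" "(t * norm B) ^ Suc m"]
      by simp
  qed (use assms in \<open>auto simp: mult_left_le_one_le\<close>)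
  then have "norm S * ((t * norm B) ^ Suc m / fact (Suc m) * exp (t * norm B)) * norm x \<le>
      norm S * ((t * norm B) ^ Suc m * exp (norm B)) * norm x"
    by (intro mult_left_mono mult_right_mono norm_ge_zero)
  also have "\<dots> = norm S * norm B ^ Suc m * exp (norm B) * t ^ Suc m * norm x"
    by (simp only: power_mult_distrib mult_ac)
  finally show ?thesis by (rule order_trans[OF obs_taylor[OF assms(1,3,4)]])
qed

section \<open>Short-time bounds for the dissipation\<close>

lemma norm_obs_le: "norm (S ((B ^ j) x)) \<le> norm S * norm B ^ j * norm x"
proof -
  have "norm (S ((B ^ j) x)) \<le> norm S * norm ((B ^ j) x)" by (rule norm_cop_apply)
  also have "\<dots> \<le> norm S * (norm B ^ j * norm x)"
    by (intro mult_left_mono norm_power_cop_apply) auto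
  finally show ?thesis by (simp add: mult.assoc)
qed

text \<open>
  For any vector \<open>g\<close> one has \<open>\<parallel>f\<parallel>\<^sup>2 \<ge> 2 f \<bullet> g - \<parallel>g\<parallel>\<^sup>2\<close>. Taking \<open>f u = S P (t u) x\<close> and for \<open>g u\<close> the Legendre polynomial
  times the Taylor coefficient of order \<open>m\<close> of \<open>f\<close>, orthogonality removes all observations of order less than \<open>m\<close>
  from the integral of the right-hand side. The bound is used for the index itself and for all smaller orders.
\<close>

lemma dissipation_lower_bound:
  "\<exists>K\<ge>0. \<forall>t x. 0 < t \<longrightarrow> t \<le> 1 \<longrightarrow>
    t ^ (2 * m) * (decay_const m * (norm (S ((B ^ m) x)))\<^sup>2 - K * t * (norm x)\<^sup>2) \<le> dissipation t x"
proof -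
  obtain M where M: "M \<ge> 0" "\<And>u. 0 \<le> u \<Longrightarrow> u \<le> 1 \<Longrightarrow> \<bar>poly (legendre m) u\<bar> \<le> M"
    using legendre_bounded[of m] by auto
  define K0 where "K0 = norm S * norm B ^ Suc m * exp (norm B)"
  have K0: "K0 \<ge> 0" by (simp add: K0_def)
  note taylor = obs_taylor_short_time[where m = m, folded K0_def]
  define K1 where "K1 = norm S * norm B ^ m"
  have K1: "K1 \<ge> 0" by (simp add: K1_def)
  have "t ^ (2 * m) * (decay_const m * (norm (S ((B ^ m) x)))\<^sup>2 - 2 * M * K0 * K1 * t * (norm x)\<^sup>2) \<le> dissipation t x"
    if t: "0 < t" "t \<le> 1" for t x
  proof -
    define v where "v j = S ((B ^ j) x)" for j
    define a where "a = ((- t) ^ m / fact m) *\<^sub>R v m"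
    define T where "T u = (\<Sum>j\<le>m. ((- (t * u)) ^ j / fact j) *\<^sub>R v j)" for u
    define f where "f u = S (P (t * u) x)" for u
    define l where "l = poly (legendre m)"
    define q where "q = (\<Sum>j\<le>m. monom ((- t) ^ j / fact j * (v j \<bullet> a)) j)"
    have q: "poly q u = T u \<bullet> a" for u
      unfolding q_def T_def poly_sum poly_monom inner_sum_left
      by (intro sum.cong refl) (simp add: power_mult_distrib[of "- t" u, simplified])
    have "degree q \<le> m"
      unfolding q_def by (intro degree_sum_le) (auto intro: order_trans[OF degree_monom_le])
    moreover have "coeff q m = a \<bullet> a"
      by (simp add: q_def coeff_sum) (simp add: a_def)
    ultimately have int_lT: "((\<lambda>u. l u * (T u \<bullet> a)) has_integral legendre_norm2 m * (a \<bullet> a)) {0..1}"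
      using legendre_orthogonal[of q m] by (simp add: q l_def)
    have norm_a: "norm a \<le> t ^ m * (K1 * norm x)"
    proof -
      have "norm a = t ^ m / fact m * norm (v m)" using t by (simp add: a_def power_abs)
      also have "\<dots> \<le> t ^ m * norm (v m)"
        using t by (intro mult_right_mono) (auto simp: divide_le_eq mult_le_cancel_left1)
      also have "\<dots> \<le> t ^ m * (K1 * norm x)"
        using t norm_obs_le[of m x] by (intro mult_left_mono) (auto simp: v_def K1_def)
      finally show ?thesis .
    qed
    define e where "e = 2 * M * K0 * K1 * t ^ (2 * m + 1) * (norm x)\<^sup>2"
    have pointwise: "2 * (l u * (T u \<bullet> a)) - (a \<bullet> a) * (l u)\<^sup>2 - e \<le> (norm (f u))\<^sup>2"
      if u: "0 \<le> u" "u \<le> 1" for u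
    proof -
      \<comment> \<open>Here \<open>a\<close> is the coefficient of \<open>u\<^sup>m\<close> in \<open>T u\<close>, and \<open>e\<close> collects the Taylor remainder.\<close>
      have "0 \<le> (norm (f u - l u *\<^sub>R a))\<^sup>2" by simp
      also have "\<dots> = (norm (f u))\<^sup>2 - 2 * (l u * (T u \<bullet> a)) - 2 * (l u * ((f u - T u) \<bullet> a)) + (a \<bullet> a) * (l u)\<^sup>2"
        unfolding power2_norm_eq_inner power2_eq_square[of "l u"]
        by (simp add: inner_simps inner_commute algebra_simps)
      finally have "2 * (l u * (T u \<bullet> a)) - (a \<bullet> a) * (l u)\<^sup>2 + 2 * (l u * ((f u - T u) \<bullet> a)) \<le> (norm (f u))\<^sup>2"
        by linarith
      moreover have "\<bar>l u * ((f u - T u) \<bullet> a)\<bar> \<le> M * ((K0 * t ^ Suc m * norm x) * (t ^ m * (K1 * norm x)))"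
        unfolding abs_mult
      proof (intro mult_mono)
        show "\<bar>l u\<bar> \<le> M" using M u by (simp add: l_def)
        have "\<bar>(f u - T u) \<bullet> a\<bar> \<le> norm (f u - T u) * norm a" by (rule Cauchy_Schwarz_ineq2)
        also have "\<dots> \<le> (K0 * t ^ Suc m * norm x) * (t ^ m * (K1 * norm x))"
          using taylor[of t u x] t u norm_a K0
          by (intro mult_mono) (auto simp: f_def T_def v_def)
        finally show "\<bar>(f u - T u) \<bullet> a\<bar> \<le> (K0 * t ^ Suc m * norm x) * (t ^ m * (K1 * norm x))" .
      qed (use M in auto)
      moreover have "2 * (M * ((K0 * t ^ Suc m * norm x) * (t ^ m * (K1 * norm x)))) = e"
      proof -
        have "t ^ (2 * m + 1) = t ^ Suc m * t ^ m" by (simp add: mult_2 flip: power_add)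
        then show ?thesis by (simp only: e_def power2_eq_square mult_ac)
      qed
      ultimately show ?thesis by linarith
    qed
    have "((\<lambda>u. 2 * (l u * (T u \<bullet> a)) - (a \<bullet> a) * (l u)\<^sup>2 - e) has_integral
        2 * (legendre_norm2 m * (a \<bullet> a)) - (a \<bullet> a) * legendre_norm2 m - e) {0..1}"
      using has_integral_diff[OF has_integral_diff[OF has_integral_mult_right[OF int_lT, of 2]
            has_integral_mult_right[OF legendre_square_has_integral[of m], of "a \<bullet> a"]]
          has_integral_const_real[of e 0 1]]
      by (simp add: l_def)
    from has_integral_le[OF this dissipation_has_integral[OF t(1), of x]]
    have "2 * (legendre_norm2 m * (a \<bullet> a)) - (a \<bullet> a) * legendre_norm2 m - e \<le> dissipation t x"
      using pointwise by (simp add: f_def)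
    moreover have "a \<bullet> a = t ^ (2 * m) * (norm (v m))\<^sup>2 / (fact m)\<^sup>2"
    proof -
      have "a \<bullet> a = ((- t) ^ m * (- t) ^ m) * (v m \<bullet> v m) / (fact m)\<^sup>2"
        by (simp add: a_def power2_eq_square)
      also have "(- t) ^ m * (- t) ^ m = t ^ (2 * m)"
        by (simp add: power_mult power2_eq_square flip: power_mult_distrib)
      finally show ?thesis by (simp add: power2_norm_eq_inner)
    qed
    ultimately show ?thesis
      by (simp add: e_def decay_const_def v_def algebra_simps)
  qed
  then show ?thesis using M K0 K1 by (intro exI[of _ "2 * M * K0 * K1"]) auto
qed

text \<open>
  The vector \<open>x = q (t B) y\<close> is chosen such that its observations make the Taylor polynomial of
  \<open>u \<mapsto> S P (t u) x\<close> to leading order a multiple of the Legendre polynomial, which is the case of equality in the lower bound.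
  Expanding the exponential and \<open>q\<close> gives a double sum of terms of order \<open>t\<^bsup>j+k\<^esup> S B\<^bsup>j+k\<^esup> y\<close>: those with \<open>j + k = m\<close>
  form the Legendre polynomial, those with \<open>j + k > m\<close> are \<open>O(t\<^bsup>m+1\<^esup>)\<close>, and those with \<open>j + k < m\<close> are so by the
  constraint on \<open>y\<close>.
\<close>

lemma dissipation_upper_bound:
  "\<exists>K\<ge>0. \<forall>t y. 0 < t \<longrightarrow> t \<le> 1 \<longrightarrow> y \<in> hc_constraint B m (t ^ Suc m) \<longrightarrow>
    (\<exists>x. dissipation t x \<le> t ^ (2 * m) * (decay_const m * (norm (S ((B ^ m) y)))\<^sup>2 + K * t) \<and>
      1 - K * t \<le> norm x)"
proof -
  define l where "l = poly (legendre m)"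
  obtain M where M: "M \<ge> 0" "\<And>u. 0 \<le> u \<Longrightarrow> u \<le> 1 \<Longrightarrow> \<bar>l u\<bar> \<le> M"
    using legendre_bounded[of m] by (auto simp: l_def)
  define K0 where "K0 = norm S * norm B ^ Suc m * exp (norm B)"
  have K0: "K0 \<ge> 0" by (simp add: K0_def)
  note taylor = obs_taylor_short_time[where m = m, folded K0_def]
  \<comment> \<open>Chosen so that \<open>(- u)\<^sup>j / j! * q (m - j)\<close> is, up to the common factor \<open>(-1)\<^sup>m / m!\<close>,
    the Legendre coefficient of order \<open>j\<close> times \<open>u\<^sup>j\<close>.\<close>
  define q where "q k = (-1) ^ k * fact (m - k) / fact m * coeff (legendre m) (m - k)" for k
  have q0: "q 0 = 1" by (simp add: q_def coeff_legendre)
  \<comment> \<open>\<open>X\<close> bounds \<open>\<parallel>x\<parallel>\<close> and \<open>\<parallel>x - y\<parallel> / t\<close>, and \<open>V\<close> bounds all observations of \<open>y\<close> of order at most \<open>2 m\<close>.\<close>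
  define X where "X = (\<Sum>k\<le>m. \<bar>q k\<bar> * norm B ^ k)"
  define V where "V = 1 + norm S * (1 + norm B) ^ (2 * m)"
  define Q where "Q = (\<Sum>j\<le>m. \<Sum>k\<le>m. \<bar>q k\<bar> * V)"
  define K1 where "K1 = Q + K0 * X"
  define K2 where "K2 = 2 * (M * V) * K1 + K1\<^sup>2"
  have nonneg: "0 \<le> X" "0 \<le> V" "0 \<le> Q" "0 \<le> K1" "0 \<le> K2"
  proof -
    show "0 \<le> X" by (simp add: X_def sum_nonneg)
    show V: "0 \<le> V" by (simp add: V_def)
    then show Q: "0 \<le> Q" by (simp add: Q_def sum_nonneg)
    with \<open>0 \<le> X\<close> K0 show K1: "0 \<le> K1" by (simp add: K1_def)
    with V M show "0 \<le> K2" by (simp add: K2_def)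
  qed
  have "\<exists>x. dissipation t x \<le> t ^ (2 * m) * (decay_const m * (norm (S ((B ^ m) y)))\<^sup>2 + (K2 + X) * t) \<and>
      1 - (K2 + X) * t \<le> norm x"
    if t: "0 < t" "t \<le> 1" and y: "y \<in> hc_constraint B m (t ^ Suc m)" for t y
  proof -
    define v where "v j = S ((B ^ j) y)" for j
    have y1: "norm y = 1" and v_small: "\<And>j. j < m \<Longrightarrow> norm (v j) \<le> t ^ Suc m"
      using y by (auto simp: hc_constraint_def v_def)
    have v_bound: "norm (v j) \<le> V" if "j \<le> 2 * m" for j
    proof -
      have "norm B ^ j \<le> (1 + norm B) ^ j" by (intro power_mono) auto
      also have "\<dots> \<le> (1 + norm B) ^ (2 * m)" using that by (intro power_increasing) auto
      finally have "norm S * norm B ^ j \<le> norm S * (1 + norm B) ^ (2 * m)" by (intro mult_left_mono) auto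
      then show ?thesis using norm_obs_le[of j y] y1 by (simp add: v_def V_def)
    qed
    have off_diagonal: "t ^ n * norm (v n) \<le> V * t ^ Suc m" if "n \<le> 2 * m" "n \<noteq> m" for n
    proof (cases "n < m")
      case True
      have "t ^ n * norm (v n) \<le> 1 * t ^ Suc m"
        using t v_small[OF True] by (intro mult_mono power_le_one) auto
      also have "\<dots> \<le> V * t ^ Suc m" using t by (intro mult_right_mono) (auto simp: V_def)
      finally show ?thesis .
    next
      case False
      then have "t ^ n \<le> t ^ Suc m" using t that by (intro power_decreasing) auto
      then show ?thesis using v_bound[OF that(1)] t nonneg
        by (subst mult.commute) (intro mult_mono, auto)
    qed
    define x where "x = (\<Sum>k\<le>m. (q k * t ^ k) *\<^sub>R (B ^ k) y)"
    have term_x: "norm ((q k * t ^ k) *\<^sub>R (B ^ k) y) \<le> t ^ k * (\<bar>q k\<bar> * norm B ^ k)" for k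
      using norm_power_cop_apply[of B k y] y1 t
      by (simp add: abs_mult mult_left_mono mult.commute mult.left_commute)
    have norm_x: "norm x \<le> X"
    proof -
      have "norm x \<le> (\<Sum>k\<le>m. t ^ k * (\<bar>q k\<bar> * norm B ^ k))"
        unfolding x_def by (rule sum_norm_le) (rule term_x)
      also have "\<dots> \<le> X"
        unfolding X_def using t by (intro sum_mono mult_left_le_one_le) (auto simp: power_le_one)
      finally show ?thesis .
    qed
    have "norm (x - y) \<le> X * t"
    proof -
      have "x - y = (\<Sum>k\<in>{1..m}. (q k * t ^ k) *\<^sub>R (B ^ k) y)"
        by (simp add: x_def atMost_atLeast0 sum.atLeast_Suc_atMost q0)
      also have "norm \<dots> \<le> (\<Sum>k\<in>{1..m}. t * (\<bar>q k\<bar> * norm B ^ k))"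
      proof (rule sum_norm_le)
        fix k assume "k \<in> {1..m}"
        then have "t ^ k \<le> t ^ 1" using t by (intro power_decreasing) auto
        then have "t ^ k * (\<bar>q k\<bar> * norm B ^ k) \<le> t * (\<bar>q k\<bar> * norm B ^ k)"
          by (intro mult_right_mono) auto
        with term_x[of k] show "norm ((q k * t ^ k) *\<^sub>R (B ^ k) y) \<le> t * (\<bar>q k\<bar> * norm B ^ k)"
          by linarith
      qed
      also have "\<dots> \<le> (\<Sum>k\<le>m. t * (\<bar>q k\<bar> * norm B ^ k))"
        using t by (intro sum_mono2) auto
      also have "\<dots> = X * t" by (simp add: X_def mult.commute flip: sum_distrib_left)
      finally show ?thesis .
    qed
    then have x_ge: "1 - X * t \<le> norm x"
      using norm_triangle_ineq2[of y x] y1 by (simp add: norm_minus_commute)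
    define f where "f u = S (P (t * u) x)" for u
    define w where "w u = ((-1) ^ m * t ^ m / fact m * l u) *\<^sub>R v m" for u
    have f_w: "norm (f u - w u) \<le> K1 * t ^ Suc m" if u: "0 \<le> u" "u \<le> 1" for u
    proof -
      define g where "g j k = ((- u) ^ j / fact j * q k * t ^ (j + k)) *\<^sub>R v (j + k)" for j k
      interpret S: bounded_linear "cop_apply S" by (rule bounded_linear_cop_apply)
      have obs_x: "S ((B ^ j) x) = (\<Sum>k\<le>m. (q k * t ^ k) *\<^sub>R v (j + k))" for j
      proof -
        interpret Bj: bounded_linear "cop_apply (B ^ j)" by (rule bounded_linear_cop_apply)
        show ?thesis
          by (simp add: x_def v_def Bj.sum S.sum Bj.scaleR S.scaleR power_add)
      qed
      have T: "(\<Sum>j\<le>m. ((- (t * u)) ^ j / fact j) *\<^sub>R S ((B ^ j) x)) = (\<Sum>j\<le>m. \<Sum>k\<le>m. g j k)"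
        unfolding obs_x scaleR_sum_right
        by (intro sum.cong refl)
          (simp add: g_def power_add power_mult_distrib[of t "- u", simplified])
      have diagonal: "(\<Sum>j\<le>m. \<Sum>k\<le>m. if j + k = m then g j k else 0) = w u"
      proof -
        have "(\<Sum>k\<le>m. if j + k = m then g j k else 0) = 
            ((-1) ^ m * t ^ m / fact m * (coeff (legendre m) j * u ^ j)) *\<^sub>R v m" if "j \<le> m" for j
        proof -
          have "(\<Sum>k\<le>m. if j + k = m then g j k else 0) = (\<Sum>k\<le>m. if k = m - j then g j k else 0)"
            using that by (intro sum.cong) auto
          also have "\<dots> = g j (m - j)" by simp
          also have "(- u) ^ j * (-1) ^ (m - j) = (-1) ^ m * u ^ j"
          proof -
            have "(-1 :: real) ^ m = (-1) ^ j * (-1) ^ (m - j)" using that by (simp flip: power_add)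
            then show ?thesis by (simp add: power_minus[of u])
          qed
          then have "g j (m - j) = ((-1) ^ m * t ^ m / fact m * (coeff (legendre m) j * u ^ j)) *\<^sub>R v m"
            using that by (simp add: g_def q_def)
          finally show ?thesis .
        qed
        then have "(\<Sum>j\<le>m. \<Sum>k\<le>m. if j + k = m then g j k else 0) =
            ((-1) ^ m * t ^ m / fact m * (\<Sum>j\<le>m. coeff (legendre m) j * u ^ j)) *\<^sub>R v m"
          by (simp add: sum_distrib_left flip: scaleR_sum_left)
        also have "(\<Sum>j\<le>m. coeff (legendre m) j * u ^ j) = l u"
          unfolding l_def
          by (subst (2) poly_as_sum_of_monoms'[OF degree_legendre, symmetric]) (simp add: poly_sum poly_monom)
        finally show ?thesis by (simp add: w_def)
      qed
      \<comment> \<open>Off the diagonal every term is \<open>O(t\<^bsup>m+1\<^esup>)\<close>.\<close>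
      have "(\<Sum>j\<le>m. \<Sum>k\<le>m. g j k) - w u = (\<Sum>j\<le>m. \<Sum>k\<le>m. if j + k = m then 0 else g j k)"
        unfolding diagonal[symmetric] sum_subtractf[symmetric] by (intro sum.cong) auto
      also have "norm \<dots> \<le> (\<Sum>j\<le>m. \<Sum>k\<le>m. \<bar>q k\<bar> * V * t ^ Suc m)"
      proof (intro sum_norm_le)
        fix j k assume jk: "j \<in> {..m}" "k \<in> {..m}"
        show "norm (if j + k = m then 0 else g j k) \<le> \<bar>q k\<bar> * V * t ^ Suc m"
        proof (cases "j + k = m")
          case False
          have "\<bar>(- u) ^ j / fact j\<bar> \<le> 1"
            using u by (simp add: power_abs divide_le_eq) (meson fact_ge_1 order_trans power_le_one)
          then have "\<bar>(- u) ^ j / fact j\<bar> * (\<bar>q k\<bar> * (t ^ (j + k) * norm (v (j + k)))) \<le> 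
              1 * (\<bar>q k\<bar> * (V * t ^ Suc m))"
            using off_diagonal[of "j + k"] jk False t
            by (intro mult_mono[OF _ mult_left_mono]) (auto intro!: mult_nonneg_nonneg)
          then show ?thesis using False t by (simp add: g_def abs_mult mult_ac)
        qed (use t nonneg in auto)
      qed
      also have "\<dots> = Q * t ^ Suc m" by (simp add: Q_def flip: sum_distrib_right)
      finally have "norm ((\<Sum>j\<le>m. \<Sum>k\<le>m. g j k) - w u) \<le> Q * t ^ Suc m" .
      moreover have "norm (f u - (\<Sum>j\<le>m. \<Sum>k\<le>m. g j k)) \<le> K0 * t ^ Suc m * X"
        using taylor[of t u x] t u norm_x K0 mult_left_mono[OF norm_x, of "K0 * t ^ Suc m"]
        by (simp add: f_def T)
      ultimately have "norm (f u - w u) \<le> K0 * t ^ Suc m * X + Q * t ^ Suc m"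
        by (rule order_trans[OF norm_triangle_ineq[of "f u - (\<Sum>j\<le>m. \<Sum>k\<le>m. g j k)"
              "(\<Sum>j\<le>m. \<Sum>k\<le>m. g j k) - w u", simplified] add_mono[rotated]])
      then show ?thesis by (simp add: K1_def algebra_simps)
    qed
    have pointwise: "(norm (f u))\<^sup>2 \<le> t ^ (2 * m) * (norm (v m))\<^sup>2 / (fact m)\<^sup>2 * (l u)\<^sup>2 + K2 * t ^ (2 * m + 1)"
      if u: "0 \<le> u" "u \<le> 1" for u
    proof -
      have w_norm: "norm (w u) = t ^ m / fact m * \<bar>l u\<bar> * norm (v m)"
        using t by (simp add: w_def abs_mult power_abs)
      have w_le: "norm (w u) \<le> t ^ m * (M * V)"
      proof -
        have "t ^ m / fact m \<le> t ^ m" using t by (simp add: divide_le_eq mult_le_cancel_left1)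
        then have "t ^ m / fact m * (\<bar>l u\<bar> * norm (v m)) \<le> t ^ m * (M * V)"
          using M u v_bound[of m] t by (intro mult_mono) auto
        then show ?thesis by (simp add: w_norm mult.assoc)
      qed
      have "norm (f u) \<le> norm (w u) + K1 * t ^ Suc m"
        using norm_triangle_sub[of "f u" "w u"] f_w[OF u] by linarith
      then have "(norm (f u))\<^sup>2 \<le> (norm (w u) + K1 * t ^ Suc m)\<^sup>2" by (intro power_mono) auto
      also have "\<dots> = (norm (w u))\<^sup>2 + 2 * (norm (w u) * (K1 * t ^ Suc m)) + K1\<^sup>2 * (t ^ Suc m)\<^sup>2"
        by (simp add: power2_sum power_mult_distrib)
      also have "norm (w u) * (K1 * t ^ Suc m) \<le> (t ^ m * (M * V)) * (K1 * t ^ Suc m)"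
        using w_le nonneg t by (intro mult_right_mono) auto
      also have "K1\<^sup>2 * (t ^ Suc m)\<^sup>2 \<le> K1\<^sup>2 * t ^ (2 * m + 1)"
        unfolding power_mult[symmetric] using t by (intro mult_left_mono power_decreasing) auto
      also have "(norm (w u))\<^sup>2 = t ^ (2 * m) * (norm (v m))\<^sup>2 / (fact m)\<^sup>2 * (l u)\<^sup>2"
        unfolding w_norm by (simp add: power_mult_distrib power_divide mult.commute flip: power_mult)
      also have "(t ^ m * (M * V)) * (K1 * t ^ Suc m) = (M * V) * K1 * t ^ (2 * m + 1)"
        by (simp add: power_add mult_2)
      finally show ?thesis by (simp add: K2_def algebra_simps)
    qed
    have int_l: "((\<lambda>u. t ^ (2 * m) * (norm (v m))\<^sup>2 / (fact m)\<^sup>2 * (l u)\<^sup>2 + K2 * t ^ (2 * m + 1))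
        has_integral t ^ (2 * m) * (norm (v m))\<^sup>2 / (fact m)\<^sup>2 * legendre_norm2 m + K2 * t ^ (2 * m + 1)) {0..1}"
      using has_integral_add[OF
          has_integral_mult_right[OF legendre_square_has_integral[of m], of "t ^ (2 * m) * (norm (v m))\<^sup>2 / (fact m)\<^sup>2"]
          has_integral_const_real[of "K2 * t ^ (2 * m + 1)" 0 1]]
      by (simp add: l_def)
    have "dissipation t x \<le> t ^ (2 * m) * (norm (v m))\<^sup>2 / (fact m)\<^sup>2 * legendre_norm2 m + K2 * t ^ (2 * m + 1)"
      by (rule has_integral_le[OF dissipation_has_integral[OF t(1)] int_l])
        (use pointwise in \<open>auto simp: f_def\<close>)
    also have "\<dots> = t ^ (2 * m) * (decay_const m * (norm (v m))\<^sup>2 + K2 * t)"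
      by (simp add: decay_const_def algebra_simps)
    also have "\<dots> \<le> t ^ (2 * m) * (decay_const m * (norm (v m))\<^sup>2 + (K2 + X) * t)"
      using t nonneg by (intro mult_left_mono add_left_mono mult_right_mono) auto
    finally have "dissipation t x \<le> t ^ (2 * m) * (decay_const m * (norm (v m))\<^sup>2 + (K2 + X) * t)" .
    moreover have "1 - (K2 + X) * t \<le> norm x"
    proof -
      have "0 \<le> K2 * t" using nonneg t by simp
      with x_ge show ?thesis by (simp add: distrib_right)
    qed
    ultimately show ?thesis unfolding v_def by blast
  qed
  then show ?thesis using nonneg by (intro exI[of _ "K2 + X"]) auto
qed

section \<open>Hypocoercivity and the existence of the index\<close>

lemma P_add: "P (s + t) = P s * P t"
  using exp_add_commuting[of "- (s *\<^sub>R B)" "- (t *\<^sub>R B)"]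
  by (simp add: scaleR_add_left mult.commute)

lemma P_of_nat_mult: "P (real n * t) = P t ^ n"
proof (induction n)
  case (Suc n)
  have "real (Suc n) * t = t + real n * t" by (simp add: algebra_simps)
  then show ?case by (simp only: P_add Suc.IH power_Suc)
qed simp

lemma norm_P_le_1: "0 \<le> t \<Longrightarrow> norm (P t) \<le> 1"
proof (cases "t = 0")
  case False
  assume "0 \<le> t"
  with False have "t > 0" by simp
  then have "(norm (P t x))\<^sup>2 \<le> (norm x)\<^sup>2" for x
    using norm_P_apply_power2[of t x] dissipation_nonneg[of t x] by simp
  then have "(norm (P t))\<^sup>2 \<le> 1"
    by (intro norm_cop_power2_le) (metis one_power2)
  then show ?thesis by (simp add: power_le_one_iff abs_square_le_1)
qed simp

text \<open>
  Split \<open>s = n t + rest\<close> with \<open>0 \<le> rest < t\<close>; the semigroup law gives a geometric factor for the first part and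
  contractivity handles the rest.
\<close>

lemma hypocoercive_if_strict_contraction:
  assumes "t > 0" and "norm (P t) < 1"
  shows "hypocoercive B"
proof -
  \<comment> \<open>The maximum with \<open>1/2\<close> makes \<open>ln r\<close> available and \<open>1 / r \<ge> 1\<close> the constant \<open>C\<close>.\<close>
  define r where "r = max (norm (P t)) (1/2)"
  have r: "0 < r" "r < 1" "norm (P t) \<le> r" using assms by (auto simp: r_def)
  define \<mu> where "\<mu> = - ln r / t"
  have "\<mu> > 0" using r assms by (simp add: \<mu>_def divide_neg_pos)
  moreover have "1 \<le> 1 / r" using r by simp
  moreover have "norm (P s x) \<le> 1 / r * exp (- \<mu> * s) * norm x" if "s \<ge> 0" for s x
  proof -
    define n where "n = nat \<lfloor>s / t\<rfloor>"
    have n: "real n \<le> s / t" "s / t < real n + 1"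
      using that assms unfolding n_def by (auto simp: of_nat_nat)
    then have rest: "0 \<le> s - real n * t" using assms by (simp add: field_simps)
    have "P s = P t ^ n * P (s - real n * t)"
      using P_add[of "real n * t" "s - real n * t"] by (simp add: P_of_nat_mult)
    also have "norm \<dots> \<le> norm (P t ^ n) * norm (P (s - real n * t))" by (rule norm_mult_ineq)
    also have "\<dots> \<le> r ^ n * 1"
      by (intro mult_mono order_trans[OF norm_power_ineq] power_mono norm_P_le_1 rest) (use r in auto)
    also have "r ^ n = r powr real n" using r by (simp add: powr_realpow)
    also have "\<dots> \<le> r powr (s / t - 1)" using r n by (intro powr_mono') auto
    also have "\<dots> = 1 / r * exp (- \<mu> * s)"
      using r by (simp add: powr_diff) (simp add: powr_def \<mu>_def mult.commute)
    finally have "norm (P s) \<le> 1 / r * exp (- \<mu> * s)" by simp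
    then have "norm (P s) * norm x \<le> 1 / r * exp (- \<mu> * s) * norm x"
      by (intro mult_right_mono) auto
    then show ?thesis using norm_cop_apply[of "P s" x] by linarith
  qed
  ultimately show ?thesis unfolding hypocoercive_def by blast
qed

lemma strict_contraction_if_hypocoercive:
  assumes "hypocoercive B"
  shows "\<exists>t>0. norm (P t) < 1"
proof -
  obtain C \<mu> where C: "C \<ge> 1" "\<mu> > 0"
    and decay: "\<And>x t. t \<ge> 0 \<Longrightarrow> norm (P t x) \<le> C * exp (- \<mu> * t) * norm x"
    using assms unfolding hypocoercive_def by blast
  \<comment> \<open>The time at which the decay estimate reads \<open>exp (- 1)\<close>.\<close>
  define t where "t = (ln C + 1) / \<mu>"
  have t: "t > 0" using C by (simp add: t_def add_nonneg_pos)
  have "norm (P t) \<le> C * exp (- \<mu> * t)"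
    using t C by (intro norm_cop_le decay) auto
  also have "- \<mu> * t = - ln C - 1" using C by (simp add: t_def field_simps)
  also have "C * exp (- ln C - 1) = exp (- 1)"
    using C by (simp add: exp_diff exp_minus inverse_eq_divide)
  also have "\<dots> < 1" by simp
  finally show ?thesis using t by blast
qed

text \<open>
  At a time \<open>t\<close> with \<open>norm (P t) < 1\<close> the dissipation dominates a multiple of \<open>\<parallel>x\<parallel>\<^sup>2\<close>. The remainder of the exponential
  series after \<open>m\<close> terms tends to \<open>0\<close> as \<open>m\<close> grows, so for large \<open>m\<close> the Taylor polynomial alone, and with it the
  observations of order at most \<open>m\<close>, dominate such a multiple.
\<close>

lemma hc_condition_if_hypocoercive:
  assumes "hypocoercive B"
  shows "\<exists>m. hc_condition B m"
proof -
  obtain t where t: "t > 0" and Pt: "norm (P t) < 1"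
    using strict_contraction_if_hypocoercive[OF assms] by blast
  define gap where "gap = 1 - (norm (P t))\<^sup>2"
  have gap: "gap > 0" using Pt by (simp add: gap_def power_less_one_iff abs_square_less_1)
  define rem where "rem m = norm S * ((t * norm B) ^ Suc m / fact (Suc m) * exp (t * norm B))" for m
  have "(\<lambda>m. inverse (fact (Suc m)) * (t * norm B) ^ Suc m) \<longlonglongrightarrow> 0"
    using summable_LIMSEQ_zero[OF summable_exp[of "t * norm B"]] by (rule LIMSEQ_Suc)
  from tendsto_mult_left[OF tendsto_mult_right[OF this, of "exp (t * norm B)"], of "norm S"]
  have "rem \<longlonglongrightarrow> 0" by (simp add: rem_def[abs_def] divide_inverse_commute)
  then have "(\<lambda>m. (rem m)\<^sup>2) \<longlonglongrightarrow> 0\<^sup>2" by (intro tendsto_power)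
  then have "\<forall>\<^sub>F m in sequentially. (rem m)\<^sup>2 < gap / (8 * t)"
    by (rule order_tendstoD) (use gap t in simp)
  then obtain m where m: "(rem m)\<^sup>2 < gap / (8 * t)"
    by (auto simp: eventually_sequentially)
  \<comment> \<open>A bound for the coefficients \<open>(t u)\<^sup>j / j!\<close> of the Taylor polynomial.\<close>
  define D where "D = (1 + t) ^ m"
  have D: "D > 0" using t by (simp add: D_def)
  define \<kappa> where "\<kappa> = gap / (8 * t * D\<^sup>2 * (real m + 1))"
  have "\<kappa> > 0" using gap t D by (simp add: \<kappa>_def)
  moreover have "\<kappa> * (norm x)\<^sup>2 \<le> (\<Sum>j\<le>m. (norm (S ((B ^ j) x)))\<^sup>2)" (is "_ \<le> ?sum") for x
  proof -
    define W where "W = 2 * (D\<^sup>2 * (?sum * (real m + 1))) + 2 * ((rem m)\<^sup>2 * (norm x)\<^sup>2)"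
    have pointwise: "(norm (S (P (t * u) x)))\<^sup>2 \<le> W" if u: "0 \<le> u" "u \<le> 1" for u
    proof -
      define T where "T = (\<Sum>j\<le>m. ((- (t * u)) ^ j / fact j) *\<^sub>R S ((B ^ j) x))"
      have "norm T \<le> (\<Sum>j\<le>m. D * norm (S ((B ^ j) x)))"
        unfolding T_def
      proof (rule sum_norm_le)
        fix j assume j: "j \<in> {..m}"
        have tu: "t * u \<le> 1 + t" using mult_left_mono[of u 1 t] t u by linarith
        have "\<bar>(- (t * u)) ^ j / fact j\<bar> \<le> \<bar>t * u\<bar> ^ j"
          using divide_left_mono[of 1 "fact j" "\<bar>t * u\<bar> ^ j"] by (simp add: power_abs)
        also have "\<dots> \<le> (1 + t) ^ j"
          using t u tu by (intro power_mono) auto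
        also have "\<dots> \<le> D" unfolding D_def using t j by (intro power_increasing) auto
        finally show "norm (((- (t * u)) ^ j / fact j) *\<^sub>R S ((B ^ j) x)) \<le> D * norm (S ((B ^ j) x))"
          unfolding norm_scaleR by (rule mult_right_mono) simp
      qed
      then have T: "norm T \<le> D * (\<Sum>j\<le>m. norm (S ((B ^ j) x)))" by (simp add: sum_distrib_left)
      have "(norm T)\<^sup>2 \<le> D\<^sup>2 * (\<Sum>j\<le>m. norm (S ((B ^ j) x)))\<^sup>2"
        using power_mono[OF T, of 2] by (simp add: power_mult_distrib)
      also have "\<dots> \<le> D\<^sup>2 * (?sum * (real m + 1))"
        using sum_squared_le_sum_of_squares[of "\<lambda>j. norm (S ((B ^ j) x))" "{..m}"]
        by (intro mult_left_mono) (auto simp: add.commute)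
      finally have T2: "(norm T)\<^sup>2 \<le> D\<^sup>2 * (?sum * (real m + 1))" .
      have "norm (S (P (t * u) x)) \<le> norm T + rem m * norm x"
        using obs_taylor[of t u x m] t u norm_triangle_sub[of "S (P (t * u) x)" T]
        by (simp add: T_def rem_def)
      then have "(norm (S (P (t * u) x)))\<^sup>2 \<le> (norm T + rem m * norm x)\<^sup>2" by (intro power_mono) auto
      also have "\<dots> \<le> 2 * (norm T)\<^sup>2 + 2 * (rem m * norm x)\<^sup>2"
        using zero_le_power2[of "norm T - rem m * norm x"] by (simp add: power2_sum power2_diff)
      finally show ?thesis using T2 by (simp add: W_def power_mult_distrib)
    qed
    have "dissipation t x \<le> W"
      using has_integral_le[OF dissipation_has_integral[OF t, of x] has_integral_const_real[of W 0 1]] pointwise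
      by simp
    then have "2 * t * dissipation t x \<le> 2 * t * W" using t by (intro mult_left_mono) auto
    moreover have "gap * (norm x)\<^sup>2 \<le> 2 * t * dissipation t x"
    proof -
      have "(norm (P t x))\<^sup>2 \<le> (norm (P t) * norm x)\<^sup>2" by (intro power_mono norm_cop_apply) auto
      then show ?thesis using norm_P_apply_power2[OF t, of x]
        by (simp add: gap_def left_diff_distrib power_mult_distrib)
    qed
    moreover have "4 * t * (rem m)\<^sup>2 * (norm x)\<^sup>2 \<le> gap / 2 * (norm x)\<^sup>2"
      using m t by (intro mult_right_mono) (auto simp: field_simps)
    ultimately have "gap / 2 * (norm x)\<^sup>2 \<le> 4 * t * D\<^sup>2 * (real m + 1) * ?sum"
      by (simp add: W_def algebra_simps)
    then have "gap * (norm x)\<^sup>2 \<le> ?sum * (8 * t * D\<^sup>2 * (real m + 1))" by (simp add: mult_ac)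
    moreover have "0 < 8 * t * D\<^sup>2 * (real m + 1)" using t D by simp
    ultimately show ?thesis
      unfolding \<kappa>_def times_divide_eq_left by (simp only: pos_divide_le_eq)
  qed
  ultimately have "hc_condition B m" unfolding hc_condition_iff by blast
  then show ?thesis ..
qed

lemma ex_hc_index_if_hypocoercive: "hypocoercive B \<Longrightarrow> \<exists>m. is_hc_index B m"
  using hc_condition_if_hypocoercive exists_least_iff[of "hc_condition B"]
  by (auto simp: is_hc_index_def)

section \<open>Short-time asymptotics of the propagator norm\<close>

definition obs_inf :: "nat \<Rightarrow> real \<Rightarrow> real"
  where "obs_inf m \<delta> = (INF y \<in> hc_constraint B m \<delta>. (norm ((S * B ^ m) y))\<^sup>2)"

text \<open>
  This is where minimality of the index enters: failure of the condition one order below supplies unit vectors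
  whose observations of order less than \<open>m\<close> are all arbitrarily small.
\<close>

lemma hc_constraint_nonempty:
  assumes "is_hc_index B m" and \<delta>: "\<delta> > 0"
  shows "hc_constraint B m \<delta> \<noteq> {}"
proof (cases m)
  case 0
  then show ?thesis using ex_unit_vector by (auto simp: hc_constraint_def)
next
  case (Suc k)
  then have "\<not> hc_condition B k" using assms by (simp add: is_hc_index_def)
  then obtain x where x: "(\<Sum>j\<le>k. (norm (S ((B ^ j) x)))\<^sup>2) < \<delta>\<^sup>2 * (norm x)\<^sup>2"
    using \<delta> unfolding hc_condition_iff by (meson not_le zero_less_power)
  have "0 \<le> (\<Sum>j\<le>k. (norm (S ((B ^ j) x)))\<^sup>2)" by (simp add: sum_nonneg)
  then have x0: "x \<noteq> 0" using x by auto
  interpret S: bounded_linear "cop_apply S" by (rule bounded_linear_cop_apply)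
  have "norm (S ((B ^ p) (x /\<^sub>R norm x))) \<le> \<delta>" if "p < m" for p
  proof -
    interpret Bp: bounded_linear "cop_apply (B ^ p)" by (rule bounded_linear_cop_apply)
    have "(norm (S ((B ^ p) x)))\<^sup>2 \<le> (\<Sum>j\<le>k. (norm (S ((B ^ j) x)))\<^sup>2)"
      using that Suc by (intro member_le_sum) auto
    then have "(norm (S ((B ^ p) x)))\<^sup>2 \<le> (\<delta> * norm x)\<^sup>2" using x by (simp add: power_mult_distrib)
    then have "norm (S ((B ^ p) x)) \<le> \<delta> * norm x" by (rule power2_le_imp_le) (use \<delta> in simp)
    then show ?thesis using x0 by (simp add: Bp.scaleR S.scaleR field_simps)
  qed
  then have "x /\<^sub>R norm x \<in> hc_constraint B m \<delta>" using x0 by (simp add: hc_constraint_def)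
  then show ?thesis by blast
qed

lemma obs_inf_le: "y \<in> hc_constraint B m \<delta> \<Longrightarrow> obs_inf m \<delta> \<le> (norm (S ((B ^ m) y)))\<^sup>2"
  unfolding obs_inf_def
  by (rule cINF_lower2[where x = y]) (auto intro!: bdd_belowI2[where m = 0])

lemma obs_inf_antimono:
  assumes "is_hc_index B m" "0 < \<delta>" "\<delta> \<le> \<delta>'"
  shows "obs_inf m \<delta>' \<le> obs_inf m \<delta>"
  unfolding obs_inf_def
proof (rule cINF_superset_mono)
  show "hc_constraint B m \<delta> \<noteq> {}" using assms by (intro hc_constraint_nonempty)
  show "hc_constraint B m \<delta> \<subseteq> hc_constraint B m \<delta>'"
    using assms(3) by (force simp: hc_constraint_def)
qed (auto intro!: bdd_belowI2[where m = 0])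

text \<open>
  Shrinking \<open>\<delta>\<close> shrinks the constraint set, so the infimum increases to its supremum. The supremum is positive because
  the index condition cannot be met by the observations of order less than \<open>m\<close> when these are small.
\<close>

lemma obs_inf_limit:
  assumes m: "is_hc_index B m"
  shows "\<exists>L>0. (obs_inf m \<longlongrightarrow> L) (at_right 0) \<and> (\<forall>\<delta>>0. obs_inf m \<delta> \<le> L)"
proof -
  have upper: "obs_inf m \<delta> \<le> (norm S * norm B ^ m)\<^sup>2" if \<delta>: "\<delta> > 0" for \<delta>
  proof -
    obtain y where y: "y \<in> hc_constraint B m \<delta>" using hc_constraint_nonempty[OF m \<delta>] by blast
    then have "norm (S ((B ^ m) y)) \<le> norm S * norm B ^ m"
      using norm_obs_le[of m y] by (simp add: hc_constraint_def)
    then show ?thesis using obs_inf_le[OF y] by (meson norm_ge_zero order_trans power_mono)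
  qed
  define L where "L = (SUP \<delta>\<in>{0<..}. obs_inf m \<delta>)"
  have bdd: "bdd_above (obs_inf m ` {0<..})" using upper by (intro bdd_aboveI2) auto
  have le_L: "obs_inf m \<delta> \<le> L" if "\<delta> > 0" for \<delta>
    unfolding L_def using that by (intro cSUP_upper bdd) auto
  have "(obs_inf m \<longlongrightarrow> L) (at_right 0)"
  proof (rule order_tendstoI)
    fix a assume "a < L"
    then obtain \<delta>' where \<delta>': "\<delta>' > 0" "a < obs_inf m \<delta>'"
      unfolding L_def by (subst (asm) less_cSUP_iff) (use bdd in auto)
    then show "\<forall>\<^sub>F \<delta> in at_right 0. a < obs_inf m \<delta>"
      unfolding eventually_at_right_field
      using obs_inf_antimono[OF m] by (intro exI[of _ \<delta>']) (auto intro: less_le_trans)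
  next
    fix a assume "L < a"
    then show "\<forall>\<^sub>F \<delta> in at_right 0. obs_inf m \<delta> < a"
      unfolding eventually_at_right_field
      using le_L by (intro exI[of _ 1]) (auto intro: le_less_trans)
  qed
  moreover have "L > 0"
  proof -
    obtain \<kappa> where \<kappa>: "\<kappa> > 0" "\<And>x. \<kappa> * (norm x)\<^sup>2 \<le> (\<Sum>j\<le>m. (norm (S ((B ^ j) x)))\<^sup>2)"
      using m unfolding is_hc_index_def hc_condition_iff by blast
    define \<delta> where "\<delta> = sqrt (\<kappa> / (2 * (real m + 1)))"
    have \<delta>: "\<delta> > 0" "\<delta>\<^sup>2 = \<kappa> / (2 * (real m + 1))" using \<kappa> by (auto simp: \<delta>_def)
    have "\<kappa> / 2 \<le> obs_inf m \<delta>"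
      unfolding obs_inf_def
    proof (rule cINF_greatest[OF hc_constraint_nonempty[OF m \<delta>(1)]])
      fix y assume y: "y \<in> hc_constraint B m \<delta>"
      have "\<kappa> \<le> (\<Sum>j<m. (norm (S ((B ^ j) y)))\<^sup>2) + (norm (S ((B ^ m) y)))\<^sup>2"
        using \<kappa>(2)[of y] y by (simp add: hc_constraint_def lessThan_Suc_atMost[symmetric])
      also have "(\<Sum>j<m. (norm (S ((B ^ j) y)))\<^sup>2) \<le> (\<Sum>j<m. \<delta>\<^sup>2)"
        using y by (intro sum_mono power_mono) (auto simp: hc_constraint_def)
      also have "(\<Sum>j<m. \<delta>\<^sup>2) \<le> \<kappa> / 2"
        using \<kappa>(1) by (simp add: \<delta>(2) field_simps)
      finally show "\<kappa> / 2 \<le> (norm ((S * B ^ m) y))\<^sup>2" by simp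
    qed
    with le_L[OF \<delta>(1)] \<kappa>(1) show ?thesis by linarith
  qed
  ultimately show ?thesis using le_L by blast
qed

text \<open>
  Let \<open>x\<close> be a unit vector. If its observations of order \<open>p < m\<close> are at most \<open>C * sqrt t\<close>, the lower bound of
  order \<open>m\<close> applies with the infimum over the constraint set. Otherwise the lower bound of some order \<open>p < m\<close> already
  gives a dissipation of at least \<open>decay_const m * L * t\<^bsup>2p+1\<^esup>\<close>, which is even larger since \<open>2 p + 1 \<le> 2 m\<close>.
\<close>

lemma norm_P_upper_bound:
  assumes m: "is_hc_index B m" and L: "L > 0" "\<And>\<delta>. \<delta> > 0 \<Longrightarrow> obs_inf m \<delta> \<le> L"
  shows "\<exists>C>0. \<exists>K. \<forall>t. 0 < t \<longrightarrow> t \<le> 1 \<longrightarrow>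
    (norm (P t))\<^sup>2 \<le> 1 - 2 * t ^ (2 * m + 1) * (decay_const m * obs_inf m (C * sqrt t) - K * t)"
proof -
  have "\<forall>p. \<exists>K\<ge>0. \<forall>t x. 0 < t \<longrightarrow> t \<le> 1 \<longrightarrow>
    t ^ (2 * p) * (decay_const p * (norm (S ((B ^ p) x)))\<^sup>2 - K * t * (norm x)\<^sup>2) \<le> dissipation t x"
    using dissipation_lower_bound by blast
  then obtain k where k: "\<And>p. k p \<ge> 0" and lower: "\<And>p t x. 0 < t \<Longrightarrow> t \<le> 1 \<Longrightarrow>
    t ^ (2 * p) * (decay_const p * (norm (S ((B ^ p) x)))\<^sup>2 - k p * t * (norm x)\<^sup>2) \<le> dissipation t x"
    by metis
  \<comment> \<open>If \<open>\<parallel>S B\<^sup>p x\<parallel>\<^sup>2 \<ge> s p * t\<close>, the lower bound of order \<open>p\<close> is at least \<open>decay_const m * L * t\<^bsup>2p+1\<^esup>\<close>.\<close>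
  define s where "s p = (k p + decay_const m * L) / decay_const p" for p
  have s: "s p \<ge> 0" for p
    using k[of p] L decay_const_pos[of p] decay_const_pos[of m] by (simp add: s_def)
  \<comment> \<open>A common bound for all \<open>sqrt (s p)\<close>; the summand \<open>1\<close> makes it positive.\<close>
  define C where "C = 1 + (\<Sum>p<m. sqrt (s p))"
  have C: "C > 0" unfolding C_def by (intro add_pos_nonneg sum_nonneg) (auto simp: s)
  have "(norm (P t))\<^sup>2 \<le> 1 - 2 * t ^ (2 * m + 1) * (decay_const m * obs_inf m (C * sqrt t) - k m * t)"
    if t: "0 < t" "t \<le> 1" for t
  proof (rule norm_cop_power2_le)
    fix x :: 'a assume x: "norm x = 1"
    have "t ^ (2 * m) * (decay_const m * obs_inf m (C * sqrt t) - k m * t) \<le> dissipation t x"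
    proof (cases "x \<in> hc_constraint B m (C * sqrt t)")
      case True
      then have "decay_const m * obs_inf m (C * sqrt t) \<le> decay_const m * (norm (S ((B ^ m) x)))\<^sup>2"
        using decay_const_pos[of m] by (intro mult_left_mono obs_inf_le) auto
      then have "t ^ (2 * m) * (decay_const m * obs_inf m (C * sqrt t) - k m * t) \<le>
          t ^ (2 * m) * (decay_const m * (norm (S ((B ^ m) x)))\<^sup>2 - k m * t * (norm x)\<^sup>2)"
        using t x by (intro mult_left_mono) auto
      then show ?thesis using lower[OF t, of m x] by linarith
    next
      case False
      then obtain p where p: "p < m" "C * sqrt t < norm (S ((B ^ p) x))"
        using x by (auto simp: hc_constraint_def not_le)
      have "sqrt (s p) \<le> (\<Sum>p<m. sqrt (s p))" using p s by (intro member_le_sum) auto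
      then have "sqrt (s p) * sqrt t \<le> C * sqrt t" using t by (intro mult_right_mono) (auto simp: C_def)
      with p(2) have "sqrt (s p) * sqrt t \<le> norm (S ((B ^ p) x))" by linarith
      then have "(sqrt (s p) * sqrt t)\<^sup>2 \<le> (norm (S ((B ^ p) x)))\<^sup>2"
        using t s by (intro power_mono) auto
      then have "s p * t \<le> (norm (S ((B ^ p) x)))\<^sup>2"
        using t s by (simp add: power_mult_distrib)
      then have "decay_const p * (s p * t) \<le> decay_const p * (norm (S ((B ^ p) x)))\<^sup>2"
        using decay_const_pos[of p] by (intro mult_left_mono) auto
      also have "decay_const p * (s p * t) = (k p + decay_const m * L) * t"
        using decay_const_pos[of p] by (simp add: s_def)
      finally have "decay_const m * L * t \<le> decay_const p * (norm (S ((B ^ p) x)))\<^sup>2 - k p * t"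
        by (simp add: distrib_right)
      then have "t ^ (2 * p) * (decay_const m * L * t) \<le>
          t ^ (2 * p) * (decay_const p * (norm (S ((B ^ p) x)))\<^sup>2 - k p * t)"
        using t by (intro mult_left_mono) auto
      also have "\<dots> \<le> dissipation t x" using lower[OF t, of p x] x by simp
      finally have "t ^ (2 * p) * (decay_const m * L * t) \<le> dissipation t x" .
      moreover have "t ^ (2 * m) * (decay_const m * obs_inf m (C * sqrt t) - k m * t) \<le>
          t ^ (2 * p + 1) * (decay_const m * L)"
      proof (rule order_trans)
        have "decay_const m * obs_inf m (C * sqrt t) \<le> decay_const m * L"
          using L C t decay_const_pos[of m] by (intro mult_left_mono) auto
        then show "t ^ (2 * m) * (decay_const m * obs_inf m (C * sqrt t) - k m * t) \<le>
            t ^ (2 * m) * (decay_const m * L)"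
          using t mult_nonneg_nonneg[OF k[of m], of t] by (intro mult_left_mono) auto
        show "t ^ (2 * m) * (decay_const m * L) \<le> t ^ (2 * p + 1) * (decay_const m * L)"
          using t p L decay_const_pos[of m] by (intro mult_right_mono power_decreasing) auto
      qed
      ultimately show ?thesis by (simp add: mult_ac)
    qed
    then have "2 * t * (t ^ (2 * m) * (decay_const m * obs_inf m (C * sqrt t) - k m * t)) \<le> 2 * t * dissipation t x"
      using t by (intro mult_left_mono) auto
    then show "(norm (P t x))\<^sup>2 \<le> 1 - 2 * t ^ (2 * m + 1) * (decay_const m * obs_inf m (C * sqrt t) - k m * t)"
      using norm_P_apply_power2[OF t(1), of x] x by (simp add: mult_ac)
  qed
  with C show ?thesis by blast
qed

lemma norm_P_lower_bound:
  assumes m: "is_hc_index B m" and L: "\<And>\<delta>. \<delta> > 0 \<Longrightarrow> obs_inf m \<delta> \<le> L"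
  shows "\<exists>K\<ge>0. \<forall>t. 0 < t \<longrightarrow> t \<le> 1 \<longrightarrow> K * t \<le> 1 \<longrightarrow>
    (1 - (norm (P t))\<^sup>2) * (1 - K * t)\<^sup>2 \<le> 2 * t ^ (2 * m + 1) * (decay_const m * (L + t) + K * t)"
proof -
  obtain K where K: "K \<ge> 0" and upper: "\<And>t y. 0 < t \<Longrightarrow> t \<le> 1 \<Longrightarrow> y \<in> hc_constraint B m (t ^ Suc m) \<Longrightarrow>
    \<exists>x. dissipation t x \<le> t ^ (2 * m) * (decay_const m * (norm (S ((B ^ m) y)))\<^sup>2 + K * t) \<and>
      1 - K * t \<le> norm x"
    using dissipation_upper_bound[of m] by blast
  have "(1 - (norm (P t))\<^sup>2) * (1 - K * t)\<^sup>2 \<le> 2 * t ^ (2 * m + 1) * (decay_const m * (L + t) + K * t)"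
    if t: "0 < t" "t \<le> 1" and Kt: "K * t \<le> 1" for t
  proof -
    have \<delta>: "0 < t ^ Suc m" using t by simp
    \<comment> \<open>The infimum need not be attained, so a minimiser up to \<open>t\<close> is used.\<close>
    have "obs_inf m (t ^ Suc m) < L + t" using L[OF \<delta>] t by linarith
    then obtain y where y: "y \<in> hc_constraint B m (t ^ Suc m)" "(norm (S ((B ^ m) y)))\<^sup>2 < L + t"
      unfolding obs_inf_def
      by (subst (asm) cINF_less_iff)
        (use hc_constraint_nonempty[OF m \<delta>] in \<open>auto intro!: bdd_belowI2[where m = 0]\<close>)
    from upper[OF t y(1)] obtain x where
      x: "dissipation t x \<le> t ^ (2 * m) * (decay_const m * (norm (S ((B ^ m) y)))\<^sup>2 + K * t)" "1 - K * t \<le> norm x"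
      by blast
    have N: "(norm (P t))\<^sup>2 \<le> 1" using norm_P_le_1[of t] t by (simp add: power_le_one)
    have "(1 - (norm (P t))\<^sup>2) * (1 - K * t)\<^sup>2 \<le> (1 - (norm (P t))\<^sup>2) * (norm x)\<^sup>2"
      using x Kt N by (intro mult_left_mono power_mono) auto
    also have "\<dots> \<le> 2 * t * dissipation t x"
    proof -
      have "(norm (P t x))\<^sup>2 \<le> (norm (P t) * norm x)\<^sup>2" by (intro power_mono norm_cop_apply) auto
      then show ?thesis using norm_P_apply_power2[OF t(1), of x]
        by (simp add: left_diff_distrib power_mult_distrib)
    qed
    also have "\<dots> \<le> 2 * t * (t ^ (2 * m) * (decay_const m * (L + t) + K * t))"
    proof -
      have "decay_const m * (norm (S ((B ^ m) y)))\<^sup>2 \<le> decay_const m * (L + t)"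
        using y decay_const_pos[of m] by (intro mult_left_mono) auto
      then have "t ^ (2 * m) * (decay_const m * (norm (S ((B ^ m) y)))\<^sup>2 + K * t) \<le>
          t ^ (2 * m) * (decay_const m * (L + t) + K * t)"
        using t by (intro mult_left_mono) auto
      with x(1) have "dissipation t x \<le> t ^ (2 * m) * (decay_const m * (L + t) + K * t)" by linarith
      then show ?thesis using t by (intro mult_left_mono) auto
    qed
    finally show ?thesis by (simp add: mult_ac)
  qed
  with K show ?thesis by blast
qed

text \<open>
  The two preceding bounds squeeze \<open>(1 - \<parallel>P t\<parallel>\<^sup>2) / (2 t\<^bsup>2m+1\<^esup>)\<close>; dividing by \<open>(1 + \<parallel>P t\<parallel>) / 2\<close>, which tends to \<open>1\<close>,
  removes the square.
\<close>

lemma norm_P_asymptotics: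
  assumes m: "is_hc_index B m" and L: "L > 0" "\<And>\<delta>. \<delta> > 0 \<Longrightarrow> obs_inf m \<delta> \<le> L"
    and lim: "(obs_inf m \<longlongrightarrow> L) (at_right 0)"
  shows "((\<lambda>t. (1 - norm (P t)) / t powr real (2 * m + 1)) \<longlongrightarrow> decay_const m * L) (at_right 0)"
proof -
  obtain C K where C: "C > 0" and upper: "\<And>t. 0 < t \<Longrightarrow> t \<le> 1 \<Longrightarrow>
      (norm (P t))\<^sup>2 \<le> 1 - 2 * t ^ (2 * m + 1) * (decay_const m * obs_inf m (C * sqrt t) - K * t)"
    using norm_P_upper_bound[OF m L] by blast
  obtain K' where K': "K' \<ge> 0" and lower: "\<And>t. 0 < t \<Longrightarrow> t \<le> 1 \<Longrightarrow> K' * t \<le> 1 \<Longrightarrow>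
      (1 - (norm (P t))\<^sup>2) * (1 - K' * t)\<^sup>2 \<le> 2 * t ^ (2 * m + 1) * (decay_const m * (L + t) + K' * t)"
    using norm_P_lower_bound[OF m L(2)] by blast
  define F where "F t = (1 - (norm (P t))\<^sup>2) / (2 * t ^ (2 * m + 1))" for t
  have t0: "((\<lambda>t. t) \<longlongrightarrow> (0::real)) (at_right 0)" by (rule tendsto_ident_at)
  have pos: "\<forall>\<^sub>F t in at_right (0::real). 0 < t" by (rule eventually_at_right_less)
  have small: "\<forall>\<^sub>F t in at_right (0::real). t < b" if "b > 0" for b
    using order_tendstoD(2)[OF t0 that] .
  have "(F \<longlongrightarrow> decay_const m * L) (at_right 0)"
  proof (rule tendsto_sandwich)
    have "((\<lambda>t. C * sqrt t) \<longlongrightarrow> C * sqrt 0) (at_right 0)" by (intro tendsto_intros t0)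
    then have "filterlim (\<lambda>t. C * sqrt t) (at_right 0) (at_right 0)"
      using eventually_mono[OF pos, of "\<lambda>t. C * sqrt t \<in> {0<..} \<and> C * sqrt t \<noteq> 0"] C
      unfolding filterlim_at by simp
    from filterlim_compose[OF lim this]
    have "((\<lambda>t. decay_const m * obs_inf m (C * sqrt t) - K * t) \<longlongrightarrow> decay_const m * L - K * 0) (at_right 0)"
      by (intro tendsto_intros t0)
    then show "((\<lambda>t. decay_const m * obs_inf m (C * sqrt t) - K * t) \<longlongrightarrow> decay_const m * L) (at_right 0)" by simp
    show "\<forall>\<^sub>F t in at_right 0. decay_const m * obs_inf m (C * sqrt t) - K * t \<le> F t"
      using pos small[of 1, simplified]
    proof eventually_elim
      case (elim t)
      then show ?case using upper[of t] by (simp add: F_def field_simps)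
    qed
    have "((\<lambda>t. (decay_const m * (L + t) + K' * t) / (1 - K' * t)\<^sup>2) \<longlongrightarrow>
        (decay_const m * (L + 0) + K' * 0) / (1 - K' * 0)\<^sup>2) (at_right 0)"
      by (intro tendsto_intros t0) simp
    then show "((\<lambda>t. (decay_const m * (L + t) + K' * t) / (1 - K' * t)\<^sup>2) \<longlongrightarrow> decay_const m * L) (at_right 0)"
      by simp
    have "0 < 1 / (K' + 1)" using K' by simp
    show "\<forall>\<^sub>F t in at_right 0. F t \<le> (decay_const m * (L + t) + K' * t) / (1 - K' * t)\<^sup>2"
      using pos small[of 1, simplified] small[OF \<open>0 < 1 / (K' + 1)\<close>]
    proof eventually_elim
      case (elim t)
      then have "K' * t < 1" using K' by (simp add: field_simps)
      then have denom: "0 < (1 - K' * t)\<^sup>2" by simp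
      have scale: "0 < 2 * t ^ (2 * m + 1)" using elim by simp
      show ?case
        unfolding F_def pos_divide_le_eq[OF scale] times_divide_eq_left pos_le_divide_eq[OF denom]
        using lower[of t] elim \<open>K' * t < 1\<close> by (simp only: mult.commute less_imp_le)
    qed
  qed
  moreover have "((\<lambda>t. 2 / (1 + norm (P t))) \<longlongrightarrow> 2 / (1 + norm (P 0))) (at_right 0)"
  proof -
    have "(P \<longlongrightarrow> P 0) (at_right 0)"
      using has_vector_derivative_continuous[OF exp_scaleR_has_vector_derivative_right[of "- B" 0 "{0<..}"]]
      by (simp add: continuous_within)
    then show ?thesis by (intro tendsto_intros) auto
  qed
  ultimately have "((\<lambda>t. F t * (2 / (1 + norm (P t)))) \<longlongrightarrow> decay_const m * L * (2 / (1 + norm (P 0)))) (at_right 0)"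
    by (rule tendsto_mult)
  then have "((\<lambda>t. F t * (2 / (1 + norm (P t)))) \<longlongrightarrow> decay_const m * L) (at_right 0)" by simp
  moreover have "\<forall>\<^sub>F t in at_right 0. F t * (2 / (1 + norm (P t))) = (1 - norm (P t)) / t powr real (2 * m + 1)"
    using pos
  proof eventually_elim
    case (elim t)
    have "1 + norm (P t) > 0" by (simp add: add_pos_nonneg)
    moreover have "1 - (norm (P t))\<^sup>2 = (1 - norm (P t)) * (1 + norm (P t))"
      by (simp add: power2_eq_square algebra_simps)
    moreover have "t powr real (2 * m + 1) = t ^ (2 * m + 1)" using elim by (rule powr_realpow)
    ultimately show ?case by (simp add: F_def)
  qed
  ultimately show ?thesis by (rule Lim_transform_eventually)
qed

lemma norm_exp_expansion_iff:
  "norm_exp_expansion B a c \<longleftrightarrow> ((\<lambda>t. (1 - norm (P t)) / t powr a) \<longlongrightarrow> c) (at_right 0)"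
proof -
  have pos: "\<forall>\<^sub>F t in at_right (0::real). 0 < t" by (rule eventually_at_right_less)
  have eq: "\<forall>\<^sub>F t in at_right 0. (norm (P t) - (1 - c * t powr a)) / t powr a = c - (1 - norm (P t)) / t powr a"
    using pos by eventually_elim (simp add: field_simps)
  have "norm_exp_expansion B a c \<longleftrightarrow>
      ((\<lambda>t. (norm (P t) - (1 - c * t powr a)) / t powr a) \<longlongrightarrow> 0) (at_right 0)"
    unfolding norm_exp_expansion_def
    using eventually_mono[OF pos, of "\<lambda>t. t powr a \<noteq> 0"] by (auto intro: smalloD_tendsto smalloI_tendsto)
  also have "\<dots> \<longleftrightarrow> ((\<lambda>t. c - (1 - norm (P t)) / t powr a) \<longlongrightarrow> 0) (at_right 0)"
    by (rule tendsto_cong[OF eq])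
  also have "\<dots> \<longleftrightarrow> ((\<lambda>t. (1 - norm (P t)) / t powr a) \<longlongrightarrow> c) (at_right 0)"
  proof
    assume "((\<lambda>t. c - (1 - norm (P t)) / t powr a) \<longlongrightarrow> 0) (at_right 0)"
    from tendsto_diff[OF tendsto_const[of c] this]
    show "((\<lambda>t. (1 - norm (P t)) / t powr a) \<longlongrightarrow> c) (at_right 0)" by simp
  next
    assume "((\<lambda>t. (1 - norm (P t)) / t powr a) \<longlongrightarrow> c) (at_right 0)"
    from tendsto_diff[OF tendsto_const[of c] this]
    show "((\<lambda>t. c - (1 - norm (P t)) / t powr a) \<longlongrightarrow> 0) (at_right 0)" by simp
  qed
  finally show ?thesis .
qed

end

lemma leading_exponent_le:
  fixes f :: "real \<Rightarrow> real"
  assumes f: "((\<lambda>t. f t / t powr a) \<longlongrightarrow> c) (at_right 0)" "((\<lambda>t. f t / t powr b) \<longlongrightarrow> d) (at_right 0)"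
    and c: "c \<noteq> 0"
  shows "b \<le> a"
proof (rule ccontr)
  assume "\<not> b \<le> a"
  have pos: "\<forall>\<^sub>F t in at_right (0::real). 0 < t" by (rule eventually_at_right_less)
  have "((\<lambda>t. t powr (b - a)) \<longlongrightarrow> 0) (at_right (0::real))"
    by (rule tendsto_zero_powrI[OF tendsto_ident_at tendsto_const])
      (use \<open>\<not> b \<le> a\<close> eventually_mono[OF pos less_imp_le] in auto)
  from tendsto_mult[OF f(2) this]
  have "((\<lambda>t. f t / t powr b * t powr (b - a)) \<longlongrightarrow> 0) (at_right 0)" by simp
  moreover have "\<forall>\<^sub>F t in at_right 0. f t / t powr b * t powr (b - a) = f t / t powr a"
    using pos by eventually_elim (simp add: powr_diff)
  ultimately have "((\<lambda>t. f t / t powr a) \<longlongrightarrow> 0) (at_right 0)" by (rule Lim_transform_eventually)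
  with f(1) have "c = 0" by (rule tendsto_unique[rotated 1]) simp
  with c show False by simp
qed

section \<open>The characterisation of hypocoercivity\<close>

theorem theorem3p8:
  fixes B :: "'a::nonzero_complex_hilbert cop"
  assumes separable: "\<exists>D :: 'a set. countable D \<and> closure D = UNIV"
    and "semi_dissipative (- B)"
  shows "(hypocoercive B \<longleftrightarrow> (\<exists>a>0. \<exists>c>0. norm_exp_expansion B a c)) \<and>
    (hypocoercive B \<longrightarrow>
      (\<exists>m. is_hc_index B m \<and>
        (\<forall>a>0. \<forall>c>0. norm_exp_expansion B a c \<longrightarrow>
          a = 2 * real m + 1 \<and>
          (\<exists>L. ((\<lambda>\<delta>. INF y \<in> hc_constraint B m \<delta>. (norm ((sqrt_cop (herm B) * B ^ m) y))\<^sup>2)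
                 \<longlongrightarrow> L) (at_right 0) \<and>
               c = 1 / (fact (2 * m + 1) * real ((2 * m) choose m)) * L))))"
proof -
  interpret accretive B
    using assms(2) by unfold_locales (simp add: semi_dissipative_def)
  have index: "\<exists>m L. is_hc_index B m \<and> L > 0 \<and> (obs_inf m \<longlongrightarrow> L) (at_right 0) \<and>
      norm_exp_expansion B (real (2 * m + 1)) (decay_const m * L)" if "hypocoercive B"
  proof -
    obtain m where m: "is_hc_index B m" using ex_hc_index_if_hypocoercive[OF \<open>hypocoercive B\<close>] by blast
    obtain L where L: "L > 0" "(obs_inf m \<longlongrightarrow> L) (at_right 0)" "\<And>\<delta>. \<delta> > 0 \<Longrightarrow> obs_inf m \<delta> \<le> L"
      using obs_inf_limit[OF m] by blast
    from norm_P_asymptotics[OF m L(1,3,2)] show ?thesis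
      using m L unfolding norm_exp_expansion_iff by blast
  qed
  have "hypocoercive B" if "norm_exp_expansion B a c" "c > 0" for a c
  proof -
    have "\<forall>\<^sub>F t in at_right 0. 0 < (1 - norm (exp (- (t *\<^sub>R B)))) / t powr a"
      using that unfolding norm_exp_expansion_iff by (auto dest: order_tendstoD)
    moreover have "\<forall>\<^sub>F t in at_right (0::real). 0 < t" by (rule eventually_at_right_less)
    ultimately have "\<forall>\<^sub>F t in at_right 0. 0 < t \<and> norm (exp (- (t *\<^sub>R B))) < 1"
      by eventually_elim (auto simp: zero_less_divide_iff)
    then obtain t where "0 < t" "norm (exp (- (t *\<^sub>R B))) < 1"
      using eventually_happens'[OF trivial_limit_at_right_real] by blast
    then show ?thesis by (rule hypocoercive_if_strict_contraction)
  qed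
  moreover have "\<exists>a>0. \<exists>c>0. norm_exp_expansion B a c" if "hypocoercive B"
  proof -
    obtain m L where "L > 0" "norm_exp_expansion B (real (2 * m + 1)) (decay_const m * L)"
      using index[OF \<open>hypocoercive B\<close>] by blast
    moreover have "real (2 * m + 1) > 0" by simp
    ultimately show ?thesis using mult_pos_pos[OF decay_const_pos] by blast
  qed
  moreover have "\<exists>m. is_hc_index B m \<and>
        (\<forall>a>0. \<forall>c>0. norm_exp_expansion B a c \<longrightarrow>
          a = 2 * real m + 1 \<and>
          (\<exists>L. ((\<lambda>\<delta>. INF y \<in> hc_constraint B m \<delta>. (norm ((sqrt_cop (herm B) * B ^ m) y))\<^sup>2)
                 \<longlongrightarrow> L) (at_right 0) \<and>
               c = 1 / (fact (2 * m + 1) * real ((2 * m) choose m)) * L))" if "hypocoercive B"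
  proof -
    obtain m L where m: "is_hc_index B m" and L: "L > 0" "(obs_inf m \<longlongrightarrow> L) (at_right 0)"
      and expansion: "norm_exp_expansion B (real (2 * m + 1)) (decay_const m * L)"
      using index[OF \<open>hypocoercive B\<close>] by blast
    have const: "decay_const m = 1 / (fact (2 * m + 1) * real ((2 * m) choose m))"
    proof -
      have "a ^ 4 / (b * d) / a\<^sup>2 = 1 / (d * (b / (a * a)))" if "a \<noteq> 0" for a b d :: real
        using that by (simp add: power4_eq_xxxx power2_eq_square)
      moreover have "real ((2 * m) choose m) = fact (2 * m) / (fact m * fact m)"
        using binomial_fact[of m "2 * m", where ?'a = real] by simp
      ultimately show ?thesis by (simp only: decay_const_def legendre_norm2_def fact_nonzero not_False_eq_True)
    qed
    have "a = 2 * real m + 1 \<and> c = decay_const m * L" if "c > 0" "norm_exp_expansion B a c" for a c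
    proof -
      note lims = that(2)[unfolded norm_exp_expansion_iff] expansion[unfolded norm_exp_expansion_iff]
      have "decay_const m * L \<noteq> 0" using decay_const_pos[of m] L by simp
      then have "a = real (2 * m + 1)"
        using leading_exponent_le[OF lims] leading_exponent_le[OF lims(2,1)] that(1) by simp
      moreover from this have "c = decay_const m * L"
        using tendsto_unique[OF trivial_limit_at_right_real lims(1)] lims(2) by simp
      ultimately show ?thesis by simp
    qed
    with m L show ?thesis
      unfolding const obs_inf_def[abs_def] by blast
  qed
  ultimately show ?thesis by blast
qed

end
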